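(* Let $\mathbb{O}$ be a small category with chosen local terminals. Suppose $X$ is a top-pseudo-simplicial symmetric strict monoidal groupoid such that $\mathsf{u}^*(X)=\mathsf{S}\,\mathrm{N}_{\ell t}(\mathbb{O})$ (strict equality). If $X$ is shuffle-like, then there is a unique operadic-category structure on $\mathbb{O}$ (extending the given category with its chosen local terminals) such that $X=\mathrm{N}_{\mathrm{opd}}(\mathbb{O})$.
   Context: FINITE ORDINALS. $\mathbb{F}$ is the category with objects $\underline n=\{1<\dots<n\}$ ($n\ge 0$) and all set maps as morphisms. For $g:\underline n\to\underline k$ and $i\in\underline k$, $g^{-1}(i)$ denotes the object of $\mathbb{F}$ with the cardinality of $\{j\in\underline n: g(j)=i\}$, and $\epsilon_{g,i}:g^{-1}(i)\to\underline n$ the unique order-preserving injection with image $\{j: g(j)=i\}$. For $f:\underline m\to\underline n$, $f^g_i:(gf)^{-1}(i)\to g^{-1}(i)$ is the unique map with $\epsilon_{g,i}f^g_i=f\epsilon_{gf,i}$. $\pi_g:\underline n\to\sum_{i=1}^k g^{-1}(i)$ (ordinal sum) is the bijection whose inverse restricts to $\epsilon_{g,i}$ on the $i$-th summand. OPERADIC CATEGORY. An operadic category is a small category $\mathbb{O}$ with: (D1) a chosen terminal object in each connected component (chosen local terminals); $\tau_R:R\to U_R$ denotes the unique map to the chosen terminal of the component of $R$; (D2) a cardinality functor $|\cdot|:\mathbb{O}\to\mathbb{F}$; (D3) for each object $R$ and $i\in|R|$ a fibre functor $\varphi_{R,i}:\mathbb{O}/R\to\mathbb{O}$, written $(g:S\to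 R)\mapsto g^{-1}(i)$ on objects and $(f:gf\to g)\mapsto (f^g_i:(gf)^{-1}(i)\to g^{-1}(i))$ on morphisms. Axioms: (A1) if $R$ is a local terminal then $|R|=\underline 1$; (A2) $(\mathrm{id}_R)^{-1}(i)$ is a chosen local terminal for all $R$, $i\in|R|$; (A3) $|g^{-1}(i)|=|g|^{-1}(i)$ and $|f^g_i|=|f|^{|g|}_i$; (A4) $\tau_R^{-1}(1)=R$, and for $g:S\to R$ the fibre map of $g$ with respect to $\tau_R$ at $1$ is $g$; (A5) for $T\xrightarrow{f}S\xrightarrow{g}R$, $i\in|R|$, $j\in|g|^{-1}(i)$ and $\epsilon j:=\epsilon_{|g|,i}(j)$, one has $(f^g_i)^{-1}(j)=f^{-1}(\epsilon j)$, and for any further $h:Q\to T$, $(h^{gf}_i)^{f^g_i}_j=h^f_{\epsilon j}$. SYMMETRIC MONOIDAL GROUPOID MONAD. For a groupoid (or set) $A$, $\mathsf{S}A$ is the free symmetric strict monoidal groupoid on $A$: objects are finite lists in $A$; a morphism $(x_i)_{i\in\underline n}\to(y_i)_{i\in\underline n}$ is a permutation $\rho$ of $\underline n$ with arrows $x_i\to y_{\rho i}$ in $A$ (so for a set $A$: a permutation with $x_i=y_{\rho i}$). The monoidal product is concatenation; elements of $A$, as one-element lists, are the monoidal generators. $\mathsf{S}$ is applied levelwise to presheaves. LOCAL-TERMINALS NERVE. $\boldsymbol\Delta^{\mathsf t}$ is the category of nonempty finite ordinals and top-element-preserving order-preserving maps. A presheaf $A$ on it is a top-split augmented simplicial object: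 objects $A_r$, $r\ge-1$, faces $d_0,\dots,d_r:A_r\to A_{r-1}$ ($r\ge0$), degeneracies $s_0,\dots,s_{r+1}:A_r\to A_{r+1}$ ($r\ge-1$), satisfying the simplicial identities. For a category $\mathcal{C}$ with chosen local terminals, $\mathrm{N}_{\ell t}(\mathcal{C})$ is the set-valued such presheaf with $\mathrm{N}_{\ell t}(\mathcal{C})_{-1}=\pi_0(\mathcal{C})$ (connected components), underlying simplicial set the ordinary nerve, $d_0$ in degree $0$ sending an object to its component, $s_0$ in degree $-1$ sending a component to its chosen terminal object, and $s_{r+1}$ in degree $r\ge0$ appending to a chain the unique map from its last object to the chosen terminal of its component. TOP-PSEUDO-SIMPLICIAL OBJECTS. A top-pseudo-simplicial symmetric strict monoidal groupoid $X$ consists of symmetric strict monoidal groupoids $X_r$ ($r\ge0$), symmetric strict monoidal functors $d_i:X_r\to X_{r-1}$ and $s_i:X_r\to X_{r+1}$ ($0\le i\le r$) strictly satisfying all simplicial identities except those equating $d_{r+1}d_{r+1}$ with $d_{r+1}d_{r+2}:X_{r+2}\to X_r$, for which there are instead invertible monoidal transformations $\beta_r:d_{r+1}d_{r+1}\Rightarrow d_{r+1}d_{r+2}$ ($r\ge0$), subject to, for all $r\ge0$: (a) $(d_{r+1}\beta_{r+1})\circ(\beta_r d_{r+2})=(\beta_r d_{r+3})\circ(\beta_r d_{r+1})$ as $2$-cells between functors $X_{r+3}\to X_r$; (b) $d_i\beta_{r+1}=\beta_r d_i$ for $0\le i\le r$; (c) $\beta_r s_{r+1}=\mathrm{id}$;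 (d) $\beta_{r+1}s_i=s_i\beta_r$ for $0\le i\le r$. $\mathsf{u}^*X$ is the top-split augmented simplicial symmetric monoidal groupoid with $(\mathsf{u}^*X)_r=X_{r+1}$ ($r\ge-1$), obtained by discarding all top face operators $d_r:X_r\to X_{r-1}$ (and the $\beta_r$). SHUFFLE-LIKE. Suppose each $X_r$ is $\mathsf{S}$ of a set (as is the case when $\mathsf{u}^*X=\mathsf{S}\mathrm{N}_{\ell t}(\mathbb{O})$). For a generator $\sigma\in X_{r+2}$ let $d_{r+2}(\sigma)=(p_1,\dots,p_k)$, let $n_i$ be the length of the list $d_{r+1}(p_i)$ and $n$ the length of $d_{r+1}d_{r+1}(\sigma)$. Then $\beta_r(\sigma)$ has an underlying bijection $\underline n\to\sum_{i=1}^k\underline{n_i}$. $X$ is shuffle-like when for all $r\ge0$ and all such $\sigma$ this is a shuffle: its inverse $\sum_i\underline{n_i}\to\underline n$ is order-preserving on each summand. OPERADIC NERVE. For an operadic category $\mathbb{O}$, with $\mathbb{O}_m$ the set of chains of $m$ composable morphisms: $\mathrm{N}_{\mathrm{opd}}(\mathbb{O})_0=\mathsf{S}\pi_0(\mathbb{O})$ and $\mathrm{N}_{\mathrm{opd}}(\mathbb{O})_r=\mathsf{S}\mathbb{O}_{r-1}$ for $r\ge1$; a generator in degree $r\ge 1$ is written $p=(T_r\to\cdots\to T_1)$. The operators $d_i$ ($0\le i\le r-1$) and $s_i$ ($0\le i\le r$) in degree $r$ are those of $\mathsf{S}\mathrm{N}_{\ell t}(\mathbb{O})$ (so $d_i$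 omits and $s_i$ repeats $T_{r-i}$, and $s_r$ appends $T_1\to U_{T_1}$). The top face operator is the symmetric strict monoidal functor given on generators by: $d_1(T)$ is the list over $i\in|T|$ of the components of $(\mathrm{id}_T)^{-1}(i)$; for $r\ge2$, $d_r(p)=(p_1,\dots,p_k)$, $k=|T_1|$, where $p_i=(h_{r-1}^{-1}(i)\to\cdots\to h_1^{-1}(i))$ is the chain of fibre maps over $i$, with $h_j:T_{j+1}\to T_1$ the composite. $\beta_r$ at a generator $(T_{r+2}\to\cdots\to T_2\xrightarrow{f_1}T_1)$ has underlying bijection $\pi_{|f_1|}:|T_2|\to\sum_{i\in|T_1|}|f_1|^{-1}(i)$. The equality $X=\mathrm{N}_{\mathrm{opd}}(\mathbb{O})$ means equality of all groupoids, operators and $2$-cells. *)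

theory Defs
  imports "HOL-Library.FuncSet" "HOL-Combinatorics.Permutations"
begin

text \<open>
  Conventions.  The ordinal with \<open>n\<close> elements is \<open>{..<n}\<close>, so indices are shifted by one with
  respect to \<open>{1..n}\<close>; in particular the unique element of the one-element ordinal is \<open>0\<close>.
  Structures are records with explicit carriers; the values of their operations outside the
  carriers carry no meaning.  Two such records denote the same structure when they have the same
  carriers and their operations agree there, and this is what the predicates named
  \<open>..._eq\<close> say.
\<close>


section \<open>Categories, functors, connected components\<close>

record ('o, 'm) cat =
  Obj :: "'o set"
  Arr :: "'m set"
  Dom :: "'m \<Rightarrow> 'o"
  Cod :: "'m \<Rightarrow> 'o"
  Ident :: "'o \<Rightarrow> 'm"
  Comp :: "'m \<Rightarrow> 'm \<Rightarrow> 'm"  \<comment> \<open>\<open>Comp C g f\<close> is \<open>g\<close> after \<open>f\<close>\<close>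

definition in_hom :: "('o, 'm, 'z) cat_scheme \<Rightarrow> 'm \<Rightarrow> 'o \<Rightarrow> 'o \<Rightarrow> bool" where
  "in_hom C f x y \<longleftrightarrow> f \<in> Arr C \<and> Dom C f = x \<and> Cod C f = y"

definition composable :: "('o, 'm, 'z) cat_scheme \<Rightarrow> 'm \<Rightarrow> 'm \<Rightarrow> bool" where
  "composable C g f \<longleftrightarrow> f \<in> Arr C \<and> g \<in> Arr C \<and> Cod C f = Dom C g"

locale category =
  fixes C :: "('o, 'm, 'z) cat_scheme"
  assumes Dom_Obj: "f \<in> Arr C \<Longrightarrow> Dom C f \<in> Obj C"
    and Cod_Obj: "f \<in> Arr C \<Longrightarrow> Cod C f \<in> Obj C"
    and Ident_in_hom: "x \<in> Obj C \<Longrightarrow> in_hom C (Ident C x) x x"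
    and Comp_in_hom: "composable C g f \<Longrightarrow> in_hom C (Comp C g f) (Dom C f) (Cod C g)"
    and Comp_Ident_left: "f \<in> Arr C \<Longrightarrow> Comp C (Ident C (Cod C f)) f = f"
    and Comp_Ident_right: "f \<in> Arr C \<Longrightarrow> Comp C f (Ident C (Dom C f)) = f"
    and Comp_assoc: "composable C g f \<Longrightarrow> composable C h g \<Longrightarrow>
      Comp C h (Comp C g f) = Comp C (Comp C h g) f"

definition invertible_arrow :: "('o, 'm, 'z) cat_scheme \<Rightarrow> 'm \<Rightarrow> bool" where
  "invertible_arrow C f \<longleftrightarrow> f \<in> Arr C \<and> (\<exists>g. in_hom C g (Cod C f) (Dom C f) \<and>
     Comp C g f = Ident C (Dom C f) \<and> Comp C f g = Ident C (Cod C f))"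

record ('o, 'a, 'p, 'b) ftr =
  fob :: "'o \<Rightarrow> 'p"
  far :: "'a \<Rightarrow> 'b"

definition fid :: "('o, 'a, 'o, 'a) ftr" where
  "fid = \<lparr>fob = id, far = id\<rparr>"

definition fcomp :: "('p, 'b, 'q, 'c) ftr \<Rightarrow> ('o, 'a, 'p, 'b) ftr \<Rightarrow> ('o, 'a, 'q, 'c) ftr"
    (infixl \<open>\<odot>\<close> 70) where
  "G \<odot> F = \<lparr>fob = fob G \<circ> fob F, far = far G \<circ> far F\<rparr>"

definition ftr_eq ::
    "('o, 'a, 'z) cat_scheme \<Rightarrow> ('o, 'a, 'p, 'b) ftr \<Rightarrow> ('o, 'a, 'p, 'b) ftr \<Rightarrow> bool" where
  "ftr_eq A F G \<longleftrightarrow> (\<forall>x \<in> Obj A. fob F x = fob G x) \<and> (\<forall>a \<in> Arr A. far F a = far G a)"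

locale catfunctor = A: category A + B: category B
  for A :: "('o, 'a, 'y) cat_scheme" and B :: "('p, 'b, 'z) cat_scheme" +
  fixes F :: "('o, 'a, 'p, 'b) ftr"
  assumes fob_Obj: "x \<in> Obj A \<Longrightarrow> fob F x \<in> Obj B"
    and far_in_hom: "a \<in> Arr A \<Longrightarrow> in_hom B (far F a) (fob F (Dom A a)) (fob F (Cod A a))"
    and far_Ident: "x \<in> Obj A \<Longrightarrow> far F (Ident A x) = Ident B (fob F x)"
    and far_Comp: "composable A b a \<Longrightarrow> far F (Comp A b a) = Comp B (far F b) (far F a)"

text \<open>The components are the classes of the equivalence relation generated by the existence of
  an arrow.\<close>

definition component :: "('o, 'm, 'z) cat_scheme \<Rightarrow> 'o \<Rightarrow> 'o set" where
  "component C x =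
     {y \<in> Obj C. (x, y) \<in> {(u, v). \<exists>f. in_hom C f u v \<or> in_hom C f v u}\<^sup>*}"

definition components :: "('o, 'm, 'z) cat_scheme \<Rightarrow> 'o set set" where
  "components C = component C ` Obj C"

definition local_terminal :: "('o, 'm, 'z) cat_scheme \<Rightarrow> 'o \<Rightarrow> bool" where
  "local_terminal C u \<longleftrightarrow> u \<in> Obj C \<and> (\<forall>x \<in> component C u. \<exists>!f. in_hom C f x u)"

text \<open>A choice of local terminals is a function \<open>t\<close> from components to objects.\<close>

locale category_with_local_terminals = category C
  for C :: "('o, 'm, 'z) cat_scheme" +
  fixes t :: "'o set \<Rightarrow> 'o"
  assumes t_in: "c \<in> components C \<Longrightarrow> t c \<in> c"
    and t_terminal: "c \<in> components C \<Longrightarrow> local_terminal C (t c)"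

definition to_terminal :: "('o, 'm, 'z) cat_scheme \<Rightarrow> ('o set \<Rightarrow> 'o) \<Rightarrow> 'o \<Rightarrow> 'm" where
  "to_terminal C t x = (THE f. in_hom C f x (t (component C x)))"


section \<open>Finite ordinals\<close>

definition F_hom :: "nat \<Rightarrow> nat \<Rightarrow> (nat \<Rightarrow> nat) set" where
  "F_hom m n = {..<m} \<rightarrow>\<^sub>E {..<n}"

text \<open>For \<open>g : n \<rightarrow> k\<close>: \<open>F_fib n g i\<close> is the fibre \<open>g\<^sup>-\<^sup>1(i)\<close>, the list \<open>F_eps_list n g i\<close>
  enumerates \<open>{j. g j = i}\<close> in increasing order, and \<open>F_eps n g i\<close> is \<open>\<epsilon>\<^sub>g\<^sub>,\<^sub>i\<close>.\<close>

definition F_fib :: "nat \<Rightarrow> (nat \<Rightarrow> nat) \<Rightarrow> nat \<Rightarrow> nat" where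
  "F_fib n g i = card {j. j < n \<and> g j = i}"

definition F_eps_list :: "nat \<Rightarrow> (nat \<Rightarrow> nat) \<Rightarrow> nat \<Rightarrow> nat list" where
  "F_eps_list n g i = filter (\<lambda>j. g j = i) [0..<n]"

definition F_eps :: "nat \<Rightarrow> (nat \<Rightarrow> nat) \<Rightarrow> nat \<Rightarrow> nat \<Rightarrow> nat" where
  "F_eps n g i a = F_eps_list n g i ! a"

text \<open>\<open>F_fib_map m n g f i\<close> is \<open>f\<^sup>g\<^sub>i : (gf)\<^sup>-\<^sup>1(i) \<rightarrow> g\<^sup>-\<^sup>1(i)\<close> for \<open>f : m \<rightarrow> n\<close> and
  \<open>g : n \<rightarrow> k\<close>.\<close>

definition F_fib_map ::
    "nat \<Rightarrow> nat \<Rightarrow> (nat \<Rightarrow> nat) \<Rightarrow> (nat \<Rightarrow> nat) \<Rightarrow> nat \<Rightarrow> nat \<Rightarrow> nat" where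
  "F_fib_map m n g f i = (\<lambda>a \<in> {..<F_fib m (compose {..<m} g f) i}.
     THE b. b < F_fib n g i \<and> F_eps n g i b = f (F_eps m (compose {..<m} g f) i a))"

text \<open>\<open>F_pi n k g\<close> is \<open>\<pi>\<^sub>g\<close> for \<open>g : n \<rightarrow> k\<close>; the ordinal sum of the fibres is identified with
  \<open>{..<n}\<close>, and the bijection is extended to \<open>nat\<close> by the identity, as is usual for
  \<open>permutes\<close>.\<close>

definition F_pi_inv :: "nat \<Rightarrow> nat \<Rightarrow> (nat \<Rightarrow> nat) \<Rightarrow> nat \<Rightarrow> nat" where
  "F_pi_inv n k g l = (if l < n then concat (map (F_eps_list n g) [0..<k]) ! l else l)"

definition F_pi :: "nat \<Rightarrow> nat \<Rightarrow> (nat \<Rightarrow> nat) \<Rightarrow> nat \<Rightarrow> nat" where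
  "F_pi n k g = inv (F_pi_inv n k g)"


section \<open>Operadic categories\<close>

text \<open>The data added to a category with chosen local terminals: the cardinality functor and the
  fibre functors.  \<open>fib_ob P g i\<close> is \<open>g\<^sup>-\<^sup>1(i)\<close> and \<open>fib_ar P g f i\<close> is \<open>f\<^sup>g\<^sub>i\<close>.\<close>

record ('o, 'm) operadic_data =
  card_ob :: "'o \<Rightarrow> nat"
  card_ar :: "'m \<Rightarrow> nat \<Rightarrow> nat"
  fib_ob :: "'m \<Rightarrow> nat \<Rightarrow> 'o"
  fib_ar :: "'m \<Rightarrow> 'm \<Rightarrow> nat \<Rightarrow> 'm"

locale operadic_category = category_with_local_terminals C t
  for C :: "('o, 'm, 'z) cat_scheme" and t :: "'o set \<Rightarrow> 'o" +
  fixes P :: "('o, 'm) operadic_data"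
  assumes card_ar_hom:
      "f \<in> Arr C \<Longrightarrow> card_ar P f \<in> F_hom (card_ob P (Dom C f)) (card_ob P (Cod C f))"
    and card_ar_Ident: "x \<in> Obj C \<Longrightarrow> card_ar P (Ident C x) = (\<lambda>j \<in> {..<card_ob P x}. j)"
    and card_ar_Comp: "composable C g f \<Longrightarrow>
      card_ar P (Comp C g f) = compose {..<card_ob P (Dom C f)} (card_ar P g) (card_ar P f)"
    \<comment> \<open>The fibre functors: an arrow \<open>gf \<rightarrow> g\<close> of the slice over \<open>R = Cod g\<close> is given by
      \<open>f\<close> with \<open>Cod f = Dom g\<close>.\<close>
    and fib_ob_Obj: "g \<in> Arr C \<Longrightarrow> i < card_ob P (Cod C g) \<Longrightarrow> fib_ob P g i \<in> Obj C"
    and fib_ar_in_hom: "composable C g f \<Longrightarrow> i < card_ob P (Cod C g) \<Longrightarrow>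
      in_hom C (fib_ar P g f i) (fib_ob P (Comp C g f) i) (fib_ob P g i)"
    and fib_ar_Ident: "g \<in> Arr C \<Longrightarrow> i < card_ob P (Cod C g) \<Longrightarrow>
      fib_ar P g (Ident C (Dom C g)) i = Ident C (fib_ob P g i)"
    and fib_ar_Comp: "composable C g f \<Longrightarrow> composable C f h \<Longrightarrow> i < card_ob P (Cod C g) \<Longrightarrow>
      fib_ar P g (Comp C f h) i = Comp C (fib_ar P g f i) (fib_ar P (Comp C g f) h i)"
    and A1: "local_terminal C x \<Longrightarrow> card_ob P x = 1"
    and A2: "x \<in> Obj C \<Longrightarrow> i < card_ob P x \<Longrightarrow> fib_ob P (Ident C x) i \<in> t ` components C"
    and A3_ob: "g \<in> Arr C \<Longrightarrow> i < card_ob P (Cod C g) \<Longrightarrow>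
      card_ob P (fib_ob P g i) = F_fib (card_ob P (Dom C g)) (card_ar P g) i"
    and A3_ar: "composable C g f \<Longrightarrow> i < card_ob P (Cod C g) \<Longrightarrow>
      card_ar P (fib_ar P g f i) =
        F_fib_map (card_ob P (Dom C f)) (card_ob P (Dom C g)) (card_ar P g) (card_ar P f) i"
    and A4_ob: "x \<in> Obj C \<Longrightarrow> fib_ob P (to_terminal C t x) 0 = x"
    and A4_ar: "g \<in> Arr C \<Longrightarrow> fib_ar P (to_terminal C t (Cod C g)) g 0 = g"
    and A5_ob: "composable C g f \<Longrightarrow> i < card_ob P (Cod C g) \<Longrightarrow>
      j < F_fib (card_ob P (Dom C g)) (card_ar P g) i \<Longrightarrow>
      fib_ob P (fib_ar P g f i) j =
        fib_ob P f (F_eps (card_ob P (Dom C g)) (card_ar P g) i j)"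
    and A5_ar: "composable C g f \<Longrightarrow> composable C f h \<Longrightarrow> i < card_ob P (Cod C g) \<Longrightarrow>
      j < F_fib (card_ob P (Dom C g)) (card_ar P g) i \<Longrightarrow>
      fib_ar P (fib_ar P g f i) (fib_ar P (Comp C g f) h i) j =
        fib_ar P f h (F_eps (card_ob P (Dom C g)) (card_ar P g) i j)"

definition operadic_eq ::
    "('o, 'm, 'z) cat_scheme \<Rightarrow> ('o, 'm) operadic_data \<Rightarrow> ('o, 'm) operadic_data \<Rightarrow> bool" where
  "operadic_eq C P Q \<longleftrightarrow>
     (\<forall>x \<in> Obj C. card_ob P x = card_ob Q x) \<and>
     (\<forall>f \<in> Arr C. card_ar P f = card_ar Q f) \<and>
     (\<forall>g \<in> Arr C. \<forall>i < card_ob P (Cod C g). fib_ob P g i = fib_ob Q g i) \<and>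
     (\<forall>g f. composable C g f \<longrightarrow>
        (\<forall>i < card_ob P (Cod C g). fib_ar P g f i = fib_ar Q g f i))"


section \<open>Symmetric strict monoidal groupoids\<close>

record ('o, 'a) ssm = "('o, 'a) cat" +
  unit_ob :: 'o
  tens_ob :: "'o \<Rightarrow> 'o \<Rightarrow> 'o"
  tens_ar :: "'a \<Rightarrow> 'a \<Rightarrow> 'a"
  symm :: "'o \<Rightarrow> 'o \<Rightarrow> 'a"  \<comment> \<open>\<open>symm G x y : x \<otimes> y \<rightarrow> y \<otimes> x\<close>\<close>

locale ssm_groupoid = category G
  for G :: "('o, 'a) ssm" +
  assumes invertible: "a \<in> Arr G \<Longrightarrow> invertible_arrow G a"
    and unit_Obj: "unit_ob G \<in> Obj G"
    and tens_Obj: "x \<in> Obj G \<Longrightarrow> y \<in> Obj G \<Longrightarrow> tens_ob G x y \<in> Obj G"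
    and tens_ob_assoc: "x \<in> Obj G \<Longrightarrow> y \<in> Obj G \<Longrightarrow> z \<in> Obj G \<Longrightarrow>
      tens_ob G (tens_ob G x y) z = tens_ob G x (tens_ob G y z)"
    and tens_ob_unit: "x \<in> Obj G \<Longrightarrow> tens_ob G (unit_ob G) x = x"
      "x \<in> Obj G \<Longrightarrow> tens_ob G x (unit_ob G) = x"
    and tens_in_hom: "a \<in> Arr G \<Longrightarrow> b \<in> Arr G \<Longrightarrow>
      in_hom G (tens_ar G a b) (tens_ob G (Dom G a) (Dom G b)) (tens_ob G (Cod G a) (Cod G b))"
    and tens_Ident: "x \<in> Obj G \<Longrightarrow> y \<in> Obj G \<Longrightarrow>
      tens_ar G (Ident G x) (Ident G y) = Ident G (tens_ob G x y)"
    and tens_Comp: "composable G b a \<Longrightarrow> composable G d c \<Longrightarrow>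
      tens_ar G (Comp G b a) (Comp G d c) = Comp G (tens_ar G b d) (tens_ar G a c)"
    and tens_ar_assoc: "a \<in> Arr G \<Longrightarrow> b \<in> Arr G \<Longrightarrow> c \<in> Arr G \<Longrightarrow>
      tens_ar G (tens_ar G a b) c = tens_ar G a (tens_ar G b c)"
    and tens_ar_unit: "a \<in> Arr G \<Longrightarrow> tens_ar G (Ident G (unit_ob G)) a = a"
      "a \<in> Arr G \<Longrightarrow> tens_ar G a (Ident G (unit_ob G)) = a"
    and symm_in_hom: "x \<in> Obj G \<Longrightarrow> y \<in> Obj G \<Longrightarrow>
      in_hom G (symm G x y) (tens_ob G x y) (tens_ob G y x)"
    and symm_natural: "a \<in> Arr G \<Longrightarrow> b \<in> Arr G \<Longrightarrow>
      Comp G (symm G (Cod G a) (Cod G b)) (tens_ar G a b) =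
      Comp G (tens_ar G b a) (symm G (Dom G a) (Dom G b))"
    and symm_involutive: "x \<in> Obj G \<Longrightarrow> y \<in> Obj G \<Longrightarrow>
      Comp G (symm G y x) (symm G x y) = Ident G (tens_ob G x y)"
    and symm_hexagon: "x \<in> Obj G \<Longrightarrow> y \<in> Obj G \<Longrightarrow> z \<in> Obj G \<Longrightarrow>
      symm G (tens_ob G x y) z =
      Comp G (tens_ar G (symm G x z) (Ident G y)) (tens_ar G (Ident G x) (symm G y z))"

definition ssm_eq :: "('o, 'a) ssm \<Rightarrow> ('o, 'a) ssm \<Rightarrow> bool" where
  "ssm_eq G H \<longleftrightarrow> Obj G = Obj H \<and> Arr G = Arr H \<and>
     (\<forall>a \<in> Arr G. Dom G a = Dom H a \<and> Cod G a = Cod H a) \<and>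
     (\<forall>x \<in> Obj G. Ident G x = Ident H x) \<and>
     (\<forall>a b. composable G b a \<longrightarrow> Comp G b a = Comp H b a) \<and>
     unit_ob G = unit_ob H \<and>
     (\<forall>x \<in> Obj G. \<forall>y \<in> Obj G. tens_ob G x y = tens_ob H x y) \<and>
     (\<forall>a \<in> Arr G. \<forall>b \<in> Arr G. tens_ar G a b = tens_ar H a b) \<and>
     (\<forall>x \<in> Obj G. \<forall>y \<in> Obj G. symm G x y = symm H x y)"

locale ssm_functor = catfunctor A B F + A: ssm_groupoid A + B: ssm_groupoid B
  for A :: "('o, 'a) ssm" and B :: "('p, 'b) ssm" and F :: "('o, 'a, 'p, 'b) ftr" +
  assumes fob_unit: "fob F (unit_ob A) = unit_ob B"
    and fob_tens: "x \<in> Obj A \<Longrightarrow> y \<in> Obj A \<Longrightarrow>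
      fob F (tens_ob A x y) = tens_ob B (fob F x) (fob F y)"
    and far_tens: "a \<in> Arr A \<Longrightarrow> b \<in> Arr A \<Longrightarrow>
      far F (tens_ar A a b) = tens_ar B (far F a) (far F b)"
    and far_symm: "x \<in> Obj A \<Longrightarrow> y \<in> Obj A \<Longrightarrow>
      far F (symm A x y) = symm B (fob F x) (fob F y)"

locale invertible_monoidal_transformation = S: ssm_functor A B F + T: ssm_functor A B G
  for A :: "('o, 'a) ssm" and B :: "('p, 'b) ssm" and F G :: "('o, 'a, 'p, 'b) ftr" +
  fixes \<eta> :: "'o \<Rightarrow> 'b"
  assumes in_hom: "x \<in> Obj A \<Longrightarrow> in_hom B (\<eta> x) (fob F x) (fob G x)"
    and natural: "a \<in> Arr A \<Longrightarrow>
      Comp B (\<eta> (Cod A a)) (far F a) = Comp B (far G a) (\<eta> (Dom A a))"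
    and monoidal_unit: "\<eta> (unit_ob A) = Ident B (unit_ob B)"
    and monoidal_tens: "x \<in> Obj A \<Longrightarrow> y \<in> Obj A \<Longrightarrow>
      \<eta> (tens_ob A x y) = tens_ar B (\<eta> x) (\<eta> y)"
    and invertible: "x \<in> Obj A \<Longrightarrow> invertible_arrow B (\<eta> x)"


section \<open>The free symmetric strict monoidal groupoid on a set\<close>

text \<open>The triple \<open>(xs, \<rho>, ys)\<close> is the arrow \<open>xs \<rightarrow> ys\<close> with underlying permutation \<open>\<rho>\<close>.\<close>

type_synonym 'x sarrow = "'x list \<times> (nat \<Rightarrow> nat) \<times> 'x list"

abbreviation underlying :: "'x sarrow \<Rightarrow> nat \<Rightarrow> nat" where
  "underlying a \<equiv> fst (snd a)"

definition S_groupoid :: "'x set \<Rightarrow> ('x list, 'x sarrow) ssm" where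
  "S_groupoid A = \<lparr>
     Obj = lists A,
     Arr = {(xs, \<rho>, ys). xs \<in> lists A \<and> ys \<in> lists A \<and> length xs = length ys \<and>
              \<rho> permutes {..<length xs} \<and> (\<forall>i < length xs. xs ! i = ys ! \<rho> i)},
     Dom = (\<lambda>(xs, \<rho>, ys). xs),
     Cod = (\<lambda>(xs, \<rho>, ys). ys),
     Ident = (\<lambda>xs. (xs, id, xs)),
     Comp = (\<lambda>(ys, \<sigma>, zs) (xs, \<rho>, ys'). (xs, \<sigma> \<circ> \<rho>, zs)),
     unit_ob = [],
     tens_ob = (@),
     tens_ar = (\<lambda>(xs, \<rho>, ys) (xs', \<rho>', ys').
       (xs @ xs',
        (\<lambda>i. if i < length xs then \<rho> i else length xs + \<rho>' (i - length xs)),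
        ys @ ys')),
     symm = (\<lambda>xs ys.
       (xs @ ys,
        (\<lambda>i. if i < length xs then i + length ys
             else if i < length xs + length ys then i - length xs
             else i),
        ys @ xs))\<rparr>"

definition S_map :: "('x \<Rightarrow> 'y) \<Rightarrow> ('x list, 'x sarrow, 'y list, 'y sarrow) ftr" where
  "S_map f = \<lparr>fob = map f, far = (\<lambda>(xs, \<rho>, ys). (map f xs, \<rho>, map f ys))\<rparr>"

text \<open>The symmetric strict monoidal functor \<open>S A \<rightarrow> S B\<close> with value \<open>\<phi> a \<in> lists B\<close> on the
  generator \<open>a\<close>.  On an arrow \<open>(xs, \<rho>, ys)\<close> it permutes the blocks of
  \<open>concat (map \<phi> xs)\<close> according to \<open>\<rho>\<close>: with \<open>ls\<close> and \<open>ms\<close> the lists of block lengths of source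
  and target, position \<open>a\<close> of block \<open>i\<close> goes to position \<open>a\<close> of block \<open>\<rho> i\<close>.\<close>

definition offset :: "nat list \<Rightarrow> nat \<Rightarrow> nat" where
  "offset ls i = sum_list (take i ls)"

definition block_perm :: "nat list \<Rightarrow> nat list \<Rightarrow> (nat \<Rightarrow> nat) \<Rightarrow> nat \<Rightarrow> nat" where
  "block_perm ls ms \<rho> k =
     (if k < sum_list ls
      then let i = (LEAST i. k < offset ls (Suc i)) in offset ms (\<rho> i) + (k - offset ls i)
      else k)"

definition S_extend :: "('x \<Rightarrow> 'y list) \<Rightarrow> ('x list, 'x sarrow, 'y list, 'y sarrow) ftr" where
  "S_extend \<phi> = \<lparr>
     fob = (\<lambda>xs. concat (map \<phi> xs)),
     far = (\<lambda>(xs, \<rho>, ys).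
       (concat (map \<phi> xs),
        block_perm (map (length \<circ> \<phi>) xs) (map (length \<circ> \<phi>) ys) \<rho>,
        concat (map \<phi> ys)))\<rparr>"


section \<open>Top-split augmented simplicial objects and the local-terminals nerve\<close>

text \<open>
  In the data of a top-split augmented simplicial object \<open>A\<close>, level \<open>n\<close> is \<open>A\<^sub>r\<close> for
  \<open>r = n - 1 \<ge> -1\<close>.  With this indexing the faces out of level \<open>n\<close> are \<open>aface A n i\<close> for
  \<open>i < n\<close>, and the degeneracies out of level \<open>n\<close> are \<open>adeg A n i\<close> for \<open>i \<le> n\<close>.
\<close>

record ('l, 'f) tsplit =
  alev :: "nat \<Rightarrow> 'l"
  aface :: "nat \<Rightarrow> nat \<Rightarrow> 'f"
  adeg :: "nat \<Rightarrow> nat \<Rightarrow> 'f"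

type_synonym ('o, 'a) tsplit_ssm = "(('o, 'a) ssm, ('o, 'a, 'o, 'a) ftr) tsplit"

definition tsplit_ssm_eq :: "('o, 'a) tsplit_ssm \<Rightarrow> ('o, 'a) tsplit_ssm \<Rightarrow> bool" where
  "tsplit_ssm_eq A B \<longleftrightarrow>
     (\<forall>n. ssm_eq (alev A n) (alev B n)) \<and>
     (\<forall>n. \<forall>i < n. ftr_eq (alev A n) (aface A n i) (aface B n i)) \<and>
     (\<forall>n. \<forall>i \<le> n. ftr_eq (alev A n) (adeg A n i) (adeg B n i))"

definition S_levelwise ::
    "('x set, 'x \<Rightarrow> 'x) tsplit \<Rightarrow> ('x list, 'x sarrow) tsplit_ssm" where
  "S_levelwise A = \<lparr>
     alev = (\<lambda>n. S_groupoid (alev A n)),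
     aface = (\<lambda>n i. S_map (aface A n i)),
     adeg = (\<lambda>n i. S_map (adeg A n i))\<rparr>"

text \<open>The elements of the nerve: \<open>Chain x [f\<^sub>1, \<dots>, f\<^sub>r]\<close> is the chain of arrows
  \<open>f\<^sub>j : x\<^sub>j\<^sub>-\<^sub>1 \<rightarrow> x\<^sub>j\<close> with \<open>x\<^sub>0 = x\<close>; the constructor \<open>Comp0\<close> is for elements of degree \<open>-1\<close>.\<close>

datatype ('o, 'm) simplex = Comp0 "'o set" | Chain 'o "'m list"

fun is_path :: "('o, 'm, 'z) cat_scheme \<Rightarrow> 'o \<Rightarrow> 'm list \<Rightarrow> bool" where
  "is_path C x [] \<longleftrightarrow> x \<in> Obj C"
| "is_path C x (f # fs) \<longleftrightarrow> f \<in> Arr C \<and> Dom C f = x \<and> is_path C (Cod C f) fs"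

definition vertex :: "('o, 'm, 'z) cat_scheme \<Rightarrow> 'o \<Rightarrow> 'm list \<Rightarrow> nat \<Rightarrow> 'o" where
  "vertex C x fs i = (if i = 0 then x else Cod C (fs ! (i - 1)))"

fun N_lt_set :: "('o, 'm, 'z) cat_scheme \<Rightarrow> nat \<Rightarrow> ('o, 'm) simplex set" where
  "N_lt_set C 0 = Comp0 ` components C"
| "N_lt_set C (Suc r) = {Chain x fs | x fs. is_path C x fs \<and> length fs = r}"

fun N_lt_face :: "('o, 'm, 'z) cat_scheme \<Rightarrow> nat \<Rightarrow> ('o, 'm) simplex \<Rightarrow> ('o, 'm) simplex" where
  "N_lt_face C i (Chain x []) = Comp0 (component C x)"
| "N_lt_face C i (Chain x (f # fs)) =
     (if i = 0 then Chain (Cod C f) fs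
      else if i = length (f # fs) then Chain x (butlast (f # fs))
      else Chain x (take (i - 1) (f # fs) @
                    Comp C ((f # fs) ! i) ((f # fs) ! (i - 1)) # drop (i + 1) (f # fs)))"

fun N_lt_deg ::
    "('o, 'm, 'z) cat_scheme \<Rightarrow> ('o set \<Rightarrow> 'o) \<Rightarrow> nat \<Rightarrow> ('o, 'm) simplex \<Rightarrow> ('o, 'm) simplex" where
  "N_lt_deg C t i (Comp0 c) = Chain (t c) []"
| "N_lt_deg C t i (Chain x fs) =
     (if i \<le> length fs
      then Chain x (take i fs @ Ident C (vertex C x fs i) # drop i fs)
      else Chain x (fs @ [to_terminal C t (vertex C x fs (length fs))]))"

definition N_lt :: "('o, 'm, 'z) cat_scheme \<Rightarrow> ('o set \<Rightarrow> 'o) \<Rightarrow>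
    (('o, 'm) simplex set, ('o, 'm) simplex \<Rightarrow> ('o, 'm) simplex) tsplit" where
  "N_lt C t = \<lparr>
     alev = N_lt_set C,
     aface = (\<lambda>n i. N_lt_face C i),
     adeg = (\<lambda>n i. N_lt_deg C t i)\<rparr>"


section \<open>Top-pseudo-simplicial symmetric strict monoidal groupoids\<close>

text \<open>\<open>face X r i\<close> is \<open>d\<^sub>i : X\<^sub>r \<rightarrow> X\<^sub>r\<^sub>-\<^sub>1\<close> (for \<open>r \<ge> 1\<close>) and \<open>deg X r i\<close> is
  \<open>s\<^sub>i : X\<^sub>r \<rightarrow> X\<^sub>r\<^sub>+\<^sub>1\<close>, both for \<open>i \<le> r\<close>; \<open>beta X r x\<close> is the component of \<open>\<beta>\<^sub>r\<close> at the object
  \<open>x\<close> of \<open>X\<^sub>r\<^sub>+\<^sub>2\<close>.\<close>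

record ('o, 'a) tps =
  lev :: "nat \<Rightarrow> ('o, 'a) ssm"
  face :: "nat \<Rightarrow> nat \<Rightarrow> ('o, 'a, 'o, 'a) ftr"
  deg :: "nat \<Rightarrow> nat \<Rightarrow> ('o, 'a, 'o, 'a) ftr"
  beta :: "nat \<Rightarrow> 'o \<Rightarrow> 'a"

locale top_pseudo_simplicial =
  fixes X :: "('o, 'a) tps"
  assumes lev: "ssm_groupoid (lev X r)"
    and face: "i \<le> Suc r \<Longrightarrow> ssm_functor (lev X (r + 1)) (lev X r) (face X (r + 1) i)"
    and deg: "i \<le> r \<Longrightarrow> ssm_functor (lev X r) (lev X (r + 1)) (deg X r i)"
    and face_face: "i < j \<Longrightarrow> j \<le> r + 2 \<Longrightarrow> (i, j) \<noteq> (r + 1, r + 2) \<Longrightarrow>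
      ftr_eq (lev X (r + 2)) (face X (r + 1) i \<odot> face X (r + 2) j)
                             (face X (r + 1) (j - 1) \<odot> face X (r + 2) i)"
    and deg_deg: "i \<le> j \<Longrightarrow> j \<le> r \<Longrightarrow>
      ftr_eq (lev X r) (deg X (r + 1) i \<odot> deg X r j) (deg X (r + 1) (j + 1) \<odot> deg X r i)"
    and face_deg_less: "i < j \<Longrightarrow> j \<le> r + 1 \<Longrightarrow>
      ftr_eq (lev X (r + 1)) (face X (r + 2) i \<odot> deg X (r + 1) j)
                             (deg X r (j - 1) \<odot> face X (r + 1) i)"
    and face_deg_id: "j \<le> r \<Longrightarrow> i = j \<or> i = j + 1 \<Longrightarrow>
      ftr_eq (lev X r) (face X (r + 1) i \<odot> deg X r j) fid"
    and face_deg_greater: "j + 1 < i \<Longrightarrow> i \<le> r + 2 \<Longrightarrow>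
      ftr_eq (lev X (r + 1)) (face X (r + 2) i \<odot> deg X (r + 1) j)
                             (deg X r j \<odot> face X (r + 1) (i - 1))"
    and beta: "invertible_monoidal_transformation (lev X (r + 2)) (lev X r)
      (face X (r + 1) (r + 1) \<odot> face X (r + 2) (r + 1))
      (face X (r + 1) (r + 1) \<odot> face X (r + 2) (r + 2))
      (beta X r)"
    and beta_a: "x \<in> Obj (lev X (r + 3)) \<Longrightarrow>
      Comp (lev X r) (far (face X (r + 1) (r + 1)) (beta X (r + 1) x))
                     (beta X r (fob (face X (r + 3) (r + 2)) x)) =
      Comp (lev X r) (beta X r (fob (face X (r + 3) (r + 3)) x))
                     (beta X r (fob (face X (r + 3) (r + 1)) x))"
    and beta_b: "i \<le> r \<Longrightarrow> x \<in> Obj (lev X (r + 3)) \<Longrightarrow>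
      far (face X (r + 1) i) (beta X (r + 1) x) = beta X r (fob (face X (r + 3) i) x)"
    and beta_c: "x \<in> Obj (lev X (r + 1)) \<Longrightarrow>
      beta X r (fob (deg X (r + 1) (r + 1)) x) =
      Ident (lev X r) (fob (face X (r + 1) (r + 1)) x)"
    and beta_d: "i \<le> r \<Longrightarrow> x \<in> Obj (lev X (r + 2)) \<Longrightarrow>
      beta X (r + 1) (fob (deg X (r + 2) i) x) = far (deg X r i) (beta X r x)"

definition tps_eq :: "('o, 'a) tps \<Rightarrow> ('o, 'a) tps \<Rightarrow> bool" where
  "tps_eq X Y \<longleftrightarrow>
     (\<forall>r. ssm_eq (lev X r) (lev Y r)) \<and>
     (\<forall>r. \<forall>i \<le> Suc r. ftr_eq (lev X (Suc r)) (face X (Suc r) i) (face Y (Suc r) i)) \<and>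
     (\<forall>r. \<forall>i \<le> r. ftr_eq (lev X r) (deg X r i) (deg Y r i)) \<and>
     (\<forall>r. \<forall>x \<in> Obj (lev X (r + 2)). beta X r x = beta Y r x)"

text \<open>The shift \<open>(u\<^sup>*X)\<^sub>r = X\<^sub>r\<^sub>+\<^sub>1\<close> is absorbed in the level indexing of \<open>tsplit\<close>.  The top faces
  \<open>face X n n\<close> are discarded because the faces out of level \<open>n\<close> of a \<open>tsplit\<close> are only
  those with index \<open>i < n\<close>.\<close>

definition u_star :: "('o, 'a) tps \<Rightarrow> ('o, 'a) tsplit_ssm" where
  "u_star X = \<lparr>alev = lev X, aface = face X, adeg = deg X\<rparr>"

text \<open>For \<open>X\<close> whose levels are of the form \<open>S A\<close>; the generators of level \<open>r + 2\<close> are the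
  \<open>\<sigma>\<close> for which \<open>[\<sigma>]\<close> is an object.\<close>

definition shuffle_like :: "('x list, 'x sarrow) tps \<Rightarrow> bool" where
  "shuffle_like X \<longleftrightarrow> (\<forall>r \<sigma>. [\<sigma>] \<in> Obj (lev X (r + 2)) \<longrightarrow>
     (let ps = fob (face X (r + 2) (r + 2)) [\<sigma>];
          ns = map (\<lambda>p. length (fob (face X (r + 1) (r + 1)) [p])) ps;
          \<rho> = underlying (beta X r [\<sigma>])
      in \<forall>i < length ps. mono_on {..<ns ! i} (\<lambda>a. inv \<rho> (offset ns i + a))))"


section \<open>The operadic nerve\<close>

text \<open>The composite of a nonempty path; the first arrow of the list is applied first.\<close>

fun composite :: "('o, 'm, 'z) cat_scheme \<Rightarrow> 'm list \<Rightarrow> 'm" where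
  "composite C [] = undefined"
| "composite C [f] = f"
| "composite C (f # g # fs) = Comp C (composite C (g # fs)) f"

text \<open>A generator \<open>T\<^sub>r \<rightarrow> \<cdots> \<rightarrow> T\<^sub>1\<close> in degree \<open>r\<close> is \<open>Chain T\<^sub>r fs\<close> with \<open>length fs = r - 1\<close>, so
  \<open>composite C (drop l fs)\<close> is the composite from the vertex with index \<open>l\<close> to \<open>T\<^sub>1\<close>, that is
  \<open>h\<^sub>j\<close> with \<open>j = r - 1 - l\<close>.\<close>

definition fibre_chain ::
    "('o, 'm, 'z) cat_scheme \<Rightarrow> ('o, 'm) operadic_data \<Rightarrow> 'm list \<Rightarrow> nat \<Rightarrow> ('o, 'm) simplex" where
  "fibre_chain C P fs i =
     Chain (fib_ob P (composite C fs) i)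
       (map (\<lambda>l. fib_ar P (composite C (drop (l + 1) fs)) (fs ! l) i) [0..<length fs - 1])"

fun N_opd_top ::
    "('o, 'm, 'z) cat_scheme \<Rightarrow> ('o, 'm) operadic_data \<Rightarrow> ('o, 'm) simplex \<Rightarrow>
     ('o, 'm) simplex list" where
  "N_opd_top C P (Chain x []) =
     map (\<lambda>i. Comp0 (component C (fib_ob P (Ident C x) i))) [0..<card_ob P x]"
| "N_opd_top C P (Chain x (f # fs)) =
     map (fibre_chain C P (f # fs)) [0..<card_ob P (Cod C (last (f # fs)))]"
| "N_opd_top C P (Comp0 c) = []"  \<comment> \<open>irrelevant: there are no faces out of degree \<open>0\<close>\<close>

definition N_opd_face ::
    "('o, 'm, 'z) cat_scheme \<Rightarrow> ('o, 'm) operadic_data \<Rightarrow> nat \<Rightarrow> nat \<Rightarrow>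
     (('o, 'm) simplex list, ('o, 'm) simplex sarrow,
      ('o, 'm) simplex list, ('o, 'm) simplex sarrow) ftr" where
  "N_opd_face C P r i = (if i < r then S_map (N_lt_face C i) else S_extend (N_opd_top C P))"

definition last_arrow :: "('o, 'm) simplex \<Rightarrow> 'm" where
  "last_arrow p = (case p of Chain x fs \<Rightarrow> last fs)"

text \<open>\<open>\<beta>\<^sub>r\<close> at a generator \<open>p\<close>, and, as \<open>\<beta>\<^sub>r\<close> is monoidal, at a list of generators.\<close>

definition N_opd_beta_gen ::
    "('o, 'm, 'z) cat_scheme \<Rightarrow> ('o, 'm) operadic_data \<Rightarrow> nat \<Rightarrow> ('o, 'm) simplex \<Rightarrow>
     ('o, 'm) simplex sarrow" where
  "N_opd_beta_gen C P r p =
     (fob (N_opd_face C P (r + 1) (r + 1) \<odot> N_opd_face C P (r + 2) (r + 1)) [p],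
      F_pi (card_ob P (Dom C (last_arrow p))) (card_ob P (Cod C (last_arrow p)))
           (card_ar P (last_arrow p)),
      fob (N_opd_face C P (r + 1) (r + 1) \<odot> N_opd_face C P (r + 2) (r + 2)) [p])"

definition N_opd :: "('o, 'm, 'z) cat_scheme \<Rightarrow> ('o set \<Rightarrow> 'o) \<Rightarrow> ('o, 'm) operadic_data \<Rightarrow>
    (('o, 'm) simplex list, ('o, 'm) simplex sarrow) tps" where
  "N_opd C t P = \<lparr>
     lev = (\<lambda>r. S_groupoid (N_lt_set C r)),
     face = N_opd_face C P,
     deg = (\<lambda>r i. S_map (N_lt_deg C t i)),
     beta = (\<lambda>r ps.
       foldr (tens_ar (S_groupoid (N_lt_set C r))) (map (N_opd_beta_gen C P r) ps)
             (Ident (S_groupoid (N_lt_set C r)) []))\<rparr>"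

end

theory Submission
  imports Defs
begin

text \<open>
  The point of the proof is that every piece of an operadic structure is already visible in the top
  faces and in the 2-cells of \<open>X\<close>, and that each axiom of an operadic category is one of the
  identities that \<open>X\<close> satisfies.  Write \<open>\<partial> \<sigma>\<close> for the list of generators that is the top face of a
  generator \<open>\<sigma>\<close>.

  The data are read off as follows.  The cardinality of \<open>T\<close> is the length of \<open>\<partial> T\<close>; as \<open>\<partial>\<close> commutes with
  the faces that omit a vertex other than the last one, \<open>\<partial> \<sigma>\<close> has as many entries as the last vertex of
  \<open>\<sigma>\<close> has points.  The \<open>i\<close>-th entry of \<open>\<partial> g\<close> is the fibre of \<open>g\<close> over \<open>i\<close>, and the \<open>i\<close>-th entry of
  \<open>\<partial> (f, g)\<close>, for composable \<open>f\<close> and \<open>g\<close>, is the fibre map.  Finally \<open>\<beta>\<^sub>0\<close> at \<open>g : S \<rightarrow> R\<close> is a bijection from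
  the points of \<open>S\<close> to the disjoint union of the points of the fibres of \<open>g\<close>, and sending a point to
  the index of its fibre is the map \<open>|g|\<close>.  The condition that \<open>X\<close> is shuffle-like says that this
  bijection carries no more information than \<open>|g|\<close>: it is \<open>\<pi>\<^sub>|\<^sub>g\<^sub>|\<close> (lemma \<open>shuffle.F_pi\<close>).

  The axioms come from three sources.  The strict simplicial identities say that fibres are functorial,
  that fibres of identities are chosen local terminals and that the fibre of an object over a chosen
  local terminal is the object itself.  The coherence (a) of \<open>\<beta>\<close> at a composable pair \<open>(f, g)\<close> compares
  two ways of distributing the points of the source of \<open>f\<close> into fibres of fibres; comparing positions
  gives at once that \<open>|g f| = |g| |f|\<close> and that the fibre maps have the maps of fibres of \<open>|f|\<close> as
  underlying maps.  That \<open>\<beta>\<close> is an arrow of a free symmetric monoidal groupoid on a set, so that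
  it permutes equal entries, gives the equality of fibres of fibre maps with fibres.  Identities
  are sent to identities for a reason of their own: \<open>|id|\<close> is idempotent, and it is injective since the
  fibres of \<open>id\<close> have one point.

  That \<open>X\<close> is the operadic nerve of this structure then amounts to three statements: a symmetric strict
  monoidal functor out of a free symmetric strict monoidal groupoid is determined by its values
  on generators, also on arrows (\<open>S_functor.far_eq_S_extend\<close>); the entries of \<open>\<partial> \<sigma>\<close> for a long
  chain \<open>\<sigma>\<close> are determined by their faces, and so by chains of at most two arrows that are obtained
  from \<open>\<sigma>\<close> by omitting vertices (\<open>tface_nth_fibre_chain\<close>); and \<open>\<beta>\<^sub>r\<close> has the same permutation as \<open>\<beta>\<^sub>0\<close> at the last arrow.
  Uniqueness holds since an operadic nerve gives back its operadic category by the recipe above.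
\<close>

section \<open>Positions in a concatenation of blocks\<close>

definition block :: "nat list \<Rightarrow> nat \<Rightarrow> nat" where
  "block ls k = (LEAST i. k < offset ls (Suc i))"

lemma offset_0 [simp]: "offset ls 0 = 0"
  by (simp add: offset_def)

lemma offset_Suc: "i < length ls \<Longrightarrow> offset ls (Suc i) = offset ls i + ls ! i"
  by (simp add: offset_def take_Suc_conv_app_nth)

lemma offset_Cons [simp]: "offset (l # ls) (Suc i) = l + offset ls i"
  by (simp add: offset_def)

lemma offset_append_left: "i \<le> length xs \<Longrightarrow> offset (xs @ ys) i = offset xs i"
  by (simp add: offset_def)

lemma offset_append_right: "offset (xs @ ys) (length xs + j) = sum_list xs + offset ys j"
  by (simp add: offset_def)

lemma offset_mono: "i \<le> j \<Longrightarrow> offset ls i \<le> offset ls j"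
  unfolding offset_def by (metis le_add1 le_Suc_ex sum_list_append take_add)

lemma offset_le_sum_list: "offset ls i \<le> sum_list ls"
  by (metis append_take_drop_id le_add1 offset_def sum_list_append)

lemma offset_add_less_sum_list:
  assumes "i < length ls" "a < ls ! i"
  shows "offset ls i + a < sum_list ls"
  using assms offset_Suc[of i ls] offset_le_sum_list[of ls "Suc i"] by linarith

lemma block_offset:
  assumes "i < length ls" "a < ls ! i"
  shows "block ls (offset ls i + a) = i"
  unfolding block_def
proof (rule Least_equality)
  show "offset ls i + a < offset ls (Suc i)"
    using assms by (simp add: offset_Suc)
next
  fix j
  assume *: "offset ls i + a < offset ls (Suc j)"
  show "i \<le> j"
  proof (rule ccontr)
    assume "\<not> i \<le> j"
    then have "offset ls (Suc j) \<le> offset ls i"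
      by (simp add: offset_mono)
    then show False using * by simp
  qed
qed

lemma position_in_block:
  assumes "k < sum_list ls"
  obtains i a where "i < length ls" "a < ls ! i" "k = offset ls i + a"
  using assms
proof (induction ls arbitrary: k thesis)
  case (Cons l ls)
  show ?case
  proof (cases "k < l")
    case True
    then show ?thesis using Cons.prems(1)[of 0 k] by simp
  next
    case False
    then have "k - l < sum_list ls" using Cons.prems by auto
    then obtain i a where "i < length ls" "a < ls ! i" "k - l = offset ls i + a"
      using Cons.IH by blast
    then show ?thesis using Cons.prems(1)[of "Suc i" a] False by simp
  qed
qed simp

lemma offset_add_eq_iff:
  assumes "i < length ls" "a < ls ! i" "j < length ls" "b < ls ! j"
  shows "offset ls i + a = offset ls j + b \<longleftrightarrow> i = j \<and> a = b"
  using assms block_offset by (metis add_left_cancel)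

lemma block_perm_offset:
  assumes "i < length ls" "a < ls ! i"
  shows "block_perm ls ms \<rho> (offset ls i + a) = offset ms (\<rho> i) + a"
  using offset_add_less_sum_list[OF assms] block_offset[OF assms]
  by (simp add: block_perm_def block_def Let_def)

lemma block_perm_outside: "sum_list ls \<le> k \<Longrightarrow> block_perm ls ms \<rho> k = k"
  by (simp add: block_perm_def)

lemma nth_concat_offset:
  assumes "i < length xss" "a < length (xss ! i)"
  shows "concat xss ! (offset (map length xss) i + a) = xss ! i ! a"
  using assms
proof (induction xss arbitrary: i)
  case (Cons xs xss)
  then show ?case by (cases i) (auto simp: nth_append)
qed simp

lemma offset_concat:
  assumes "i < length Ls" "j \<le> length (Ls ! i)"
  shows "offset (concat Ls) (offset (map length Ls) i + j) =
         offset (map sum_list Ls) i + offset (Ls ! i) j"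
  using assms
proof (induction Ls arbitrary: i)
  case (Cons L Ls)
  show ?case
  proof (cases i)
    case 0
    then show ?thesis using Cons.prems by (simp add: offset_append_left)
  next
    case (Suc i')
    then show ?thesis using Cons by (simp add: offset_append_right add.assoc)
  qed
qed simp

section \<open>Shuffles\<close>

lemma F_fib_eq_length: "F_fib n g i = length (F_eps_list n g i)"
  unfolding F_fib_def F_eps_list_def length_filter_conv_card
  by (rule arg_cong[where f = card]) auto

lemma F_pi_inv_concat:
  assumes "\<rho> permutes {..<n}" and "concat (map (F_eps_list n g) [0..<k]) = map (inv \<rho>) [0..<n]"
  shows "F_pi n k g = \<rho>"
proof -
  have "F_pi_inv n k g = inv \<rho>"
    using assms permutes_not_in[OF permutes_inv[OF assms(1)]] by (auto simp: F_pi_inv_def fun_eq_iff)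
  then show ?thesis
    using assms(1) by (simp add: F_pi_def inv_inv_eq permutes_bij)
qed

lemma concat_map_offset:
  "concat (map (\<lambda>i. map (\<lambda>a. f (offset ns i + a)) [0..<ns ! i]) [0..<length ns]) = map f [0..<sum_list ns]"
proof (induction ns arbitrary: f)
  case (Cons m ns)
  have "[0..<length (m # ns)] = 0 # map Suc [0..<length ns]"
    by (metis length_Cons map_Suc_upt upt_conv_Cons zero_less_Suc)
  then have "concat (map (\<lambda>i. map (\<lambda>a. f (offset (m # ns) i + a)) [0..<(m # ns) ! i]) [0..<length (m # ns)])
     = map f [0..<m] @ concat (map (\<lambda>i. map (\<lambda>a. (\<lambda>k. f (m + k)) (offset ns i + a)) [0..<ns ! i]) [0..<length ns])"
    by (simp add: comp_def add.assoc)
  also have "\<dots> = map f [0..<m] @ map (\<lambda>k. f (m + k)) [0..<sum_list ns]"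
    by (subst Cons.IH) simp
  also have "map (\<lambda>k. f (m + k)) [0..<sum_list ns] = map f [m..<m + sum_list ns]"
    by (rule nth_equalityI) auto
  also have "map f [0..<m] @ \<dots> = map f [0..<sum_list (m # ns)]"
    by (simp flip: map_append upt_add_eq_append)
  finally show ?case .
qed simp

text \<open>The permutation \<open>\<rho>\<close> distributes \<open>n\<close> points over blocks of sizes \<open>ns\<close>, keeping the order inside each
  block, and \<open>g\<close> is the map that it induces from points to blocks.\<close>
locale shuffle =
  fixes ns :: "nat list" and \<rho> :: "nat \<Rightarrow> nat" and n :: nat and g :: "nat \<Rightarrow> nat"
  assumes n: "n = sum_list ns"
    and permutes: "\<rho> permutes {..<n}"
    and mono: "i < length ns \<Longrightarrow> mono_on {..<ns ! i} (\<lambda>a. inv \<rho> (offset ns i + a))"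
    and g: "j < n \<Longrightarrow> g j = block ns (\<rho> j)"
begin

lemma inv_less: "k < n \<Longrightarrow> inv \<rho> k < n"
  using permutes_in_image[OF permutes_inv[OF permutes]] by auto

lemma less: "k < n \<Longrightarrow> \<rho> k < n"
  using permutes_in_image[OF permutes] by auto

text \<open>Both lists are increasing and enumerate the points that \<open>\<rho>\<close> puts into block \<open>i\<close>.  So
  the position of a point in its fibre is its position in its block.\<close>
lemma eps_list:
  assumes i: "i < length ns"
  shows "F_eps_list n g i = map (\<lambda>a. inv \<rho> (offset ns i + a)) [0..<ns ! i]"
proof (rule sorted_distinct_set_unique)
  show "sorted (F_eps_list n g i)" "distinct (F_eps_list n g i)"
    by (auto simp: F_eps_list_def sorted_wrt_filter)
  show "sorted (map (\<lambda>a. inv \<rho> (offset ns i + a)) [0..<ns ! i])"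
    using mono[OF i] by (auto simp: sorted_iff_nth_mono mono_on_def)
  show "distinct (map (\<lambda>a. inv \<rho> (offset ns i + a)) [0..<ns ! i])"
    by (auto simp: distinct_map inj_on_def permutes_inverses[OF permutes] dest: permutes_inj[OF permutes_inv[OF permutes], THEN injD])
  show "set (F_eps_list n g i) = set (map (\<lambda>a. inv \<rho> (offset ns i + a)) [0..<ns ! i])"
  proof (intro equalityI subsetI)
    fix j
    assume "j \<in> set (F_eps_list n g i)"
    then have j: "j < n" "g j = i" by (auto simp: F_eps_list_def)
    then have "\<rho> j < sum_list ns" using less n by simp
    then obtain i' a where a: "i' < length ns" "a < ns ! i'" "\<rho> j = offset ns i' + a"
      by (rule position_in_block)
    then have "i' = i" using j g block_offset by metis
    then have "j = inv \<rho> (offset ns i + a)" "a < ns ! i"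
      using a permutes_inverses(2)[OF permutes, of j] by auto
    then show "j \<in> set (map (\<lambda>a. inv \<rho> (offset ns i + a)) [0..<ns ! i])" by auto
  next
    fix j
    assume "j \<in> set (map (\<lambda>a. inv \<rho> (offset ns i + a)) [0..<ns ! i])"
    then obtain a where a: "a < ns ! i" "j = inv \<rho> (offset ns i + a)" by auto
    then have "\<rho> j = offset ns i + a" by (simp add: permutes_inverses(1)[OF permutes])
    moreover have "j < n"
      using a offset_add_less_sum_list[OF i] n inv_less by simp
    ultimately have "g j = i" using g block_offset[OF i a(1)] by simp
    then show "j \<in> set (F_eps_list n g i)" using \<open>j < n\<close> by (simp add: F_eps_list_def)
  qed
qed

lemma perm_eps: "i < length ns \<Longrightarrow> a < ns ! i \<Longrightarrow> \<rho> (F_eps n g i a) = offset ns i + a"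
  by (simp add: F_eps_def eps_list permutes_inverses(1)[OF permutes])

lemma eps_eq:
  assumes "i < length ns" "a < ns ! i" "\<rho> j = offset ns i + a"
  shows "F_eps n g i a = j"
  using assms perm_eps permutes_inj[OF permutes] by (metis injD)

lemma eps_inj:
  "i < length ns \<Longrightarrow> a < ns ! i \<Longrightarrow> b < ns ! i \<Longrightarrow> F_eps n g i a = F_eps n g i b \<longleftrightarrow> a = b"
  using perm_eps by (metis add_left_cancel)

lemma eps_less:
  assumes "i < length ns" "a < ns ! i"
  shows "F_eps n g i a < n"
proof -
  have "offset ns i + a < n"
    using offset_add_less_sum_list[OF assms] n by simp
  then show ?thesis
    using assms inv_less by (simp add: F_eps_def eps_list)
qed

lemma F_fib: "i < length ns \<Longrightarrow> F_fib n g i = ns ! i"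
proof -
  assume i: "i < length ns"
  then show ?thesis by (simp add: F_fib_eq_length eps_list)
qed

text \<open>A shuffle can be recovered from the map to the blocks alone.\<close>
lemma F_pi: "F_pi n (length ns) g = \<rho>"
proof (rule F_pi_inv_concat[OF permutes])
  have "concat (map (F_eps_list n g) [0..<length ns]) =
        concat (map (\<lambda>i. map (\<lambda>a. inv \<rho> (offset ns i + a)) [0..<ns ! i]) [0..<length ns])"
    by (rule arg_cong[where f = concat]) (simp add: eps_list)
  also have "\<dots> = map (inv \<rho>) [0..<sum_list ns]" by (rule concat_map_offset)
  finally show "concat (map (F_eps_list n g) [0..<length ns]) = map (inv \<rho>) [0..<n]" using n by simp
qed

end

text \<open>Conversely the map can be recovered from its shuffle and the sizes of its fibres; this is what
  makes the cardinality functor unique.\<close>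
lemma block_F_pi:
  assumes g: "g \<in> F_hom n k" and j: "j < n"
  shows "block (map (F_fib n g) [0..<k]) (F_pi n k g j) = g j"
proof -
  let ?xss = "map (F_eps_list n g) [0..<k]"
  let ?L = "concat ?xss"
  have gj: "g j' < k" if "j' < n" for j' using g that by (auto simp: F_hom_def)
  have set: "set ?L = {..<n}"
    using gj by (auto simp: F_eps_list_def)
  have "length ?L = (\<Sum>i<k. card {j. j < n \<and> g j = i})"
    by (simp add: length_concat F_fib_def comp_def sum_list_sum_nth atLeast0LessThan flip: F_fib_eq_length)
  also have "\<dots> = card (\<Union>i<k. {j. j < n \<and> g j = i})"
    by (rule card_UN_disjoint[symmetric]) auto
  also have "(\<Union>i<k. {j. j < n \<and> g j = i}) = {..<n}"
    using gj by auto
  finally have len: "length ?L = n" by simp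
  then have "distinct ?L"
    using set by (intro card_distinct) simp
  then have "bij_betw (nth ?L) {..<n} {..<n}"
    using bij_betw_nth[of ?L "{..<n}" "{..<n}"] set len by simp
  then have "bij_betw (F_pi_inv n k g) {..<n} {..<n}"
    by (rule bij_betw_cong[THEN iffD1, rotated]) (simp add: F_pi_inv_def)
  then have permutes: "F_pi_inv n k g permutes {..<n}"
    by (rule bij_imp_permutes) (simp add: F_pi_inv_def)
  have map_len: "map length ?xss = map (F_fib n g) [0..<k]"
    by (simp add: F_fib_eq_length)
  have "F_pi n k g j < n"
    using permutes_in_image[OF permutes_inv[OF permutes], of j] j by (simp add: F_pi_def)
  then have "F_pi n k g j < sum_list (map (F_fib n g) [0..<k])"
    using len by (simp add: length_concat flip: map_len)
  then obtain i a where ia: "i < length (map (F_fib n g) [0..<k])" "a < map (F_fib n g) [0..<k] ! i"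
    "F_pi n k g j = offset (map (F_fib n g) [0..<k]) i + a"
    by (rule position_in_block)
  have "j = F_pi_inv n k g (F_pi n k g j)"
    by (simp add: F_pi_def permutes_inverses[OF permutes])
  also have "\<dots> = ?L ! F_pi n k g j"
    using \<open>F_pi n k g j < n\<close> by (simp add: F_pi_inv_def)
  also have "\<dots> = F_eps_list n g i ! a"
    using ia nth_concat_offset[of i ?xss a] by (simp add: F_fib_eq_length flip: map_len)
  also have "\<dots> \<in> set (F_eps_list n g i)"
    using ia by (intro nth_mem) (simp add: F_fib_eq_length)
  finally have "g j = i" by (simp add: F_eps_list_def)
  then show ?thesis using ia block_offset by metis
qed

section \<open>Symmetric strict monoidal functors between free groupoids\<close>

lemma S_groupoid_simps [simp]:
  "Obj (S_groupoid A) = lists A"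
  "Dom (S_groupoid A) (xs, \<rho>, ys) = xs"
  "Cod (S_groupoid A) (xs, \<rho>, ys) = ys"
  "Ident (S_groupoid A) xs = (xs, id, xs)"
  "Comp (S_groupoid A) (ys', \<sigma>, zs) (xs, \<rho>, ys) = (xs, \<sigma> \<circ> \<rho>, zs)"
  "unit_ob (S_groupoid A) = []"
  "tens_ob (S_groupoid A) xs ys = xs @ ys"
  by (simp_all add: S_groupoid_def)

lemma S_groupoid_Dom_Cod: "Dom (S_groupoid A) a = fst a" "Cod (S_groupoid A) a = snd (snd a)"
  by (simp_all add: S_groupoid_def split: prod.split)

lemma Arr_S_groupoid_iff:
  "(xs, \<rho>, ys) \<in> Arr (S_groupoid A) \<longleftrightarrow> xs \<in> lists A \<and> ys \<in> lists A \<and> length xs = length ys \<and>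
     \<rho> permutes {..<length xs} \<and> (\<forall>i < length xs. xs ! i = ys ! \<rho> i)"
  by (simp add: S_groupoid_def)

text \<open>The levels of \<open>X\<close> agree with free groupoids only on their carriers.  The following locale is what a
  symmetric strict monoidal functor between such levels amounts to in terms of lists and
  permutations; closure of the arrows under the structure of the source is included, because it is
  inherited from the level.\<close>
locale S_functor =
  fixes A :: "'x set" and B :: "'y set" and F :: "('x list, 'x sarrow, 'y list, 'y sarrow) ftr"
  assumes tens_Arr: "a \<in> Arr (S_groupoid A) \<Longrightarrow> b \<in> Arr (S_groupoid A) \<Longrightarrow>
      tens_ar (S_groupoid A) a b \<in> Arr (S_groupoid A)"
    and symm_Arr: "xs \<in> lists A \<Longrightarrow> ys \<in> lists A \<Longrightarrow> symm (S_groupoid A) xs ys \<in> Arr (S_groupoid A)"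
    and far_in_hom: "a \<in> Arr (S_groupoid A) \<Longrightarrow>
      in_hom (S_groupoid B) (far F a) (fob F (Dom (S_groupoid A) a)) (fob F (Cod (S_groupoid A) a))"
    and fob_lists: "xs \<in> lists A \<Longrightarrow> fob F xs \<in> lists B"
    and far_Ident: "xs \<in> lists A \<Longrightarrow> far F (xs, id, xs) = (fob F xs, id, fob F xs)"
    and far_Comp: "composable (S_groupoid A) b a \<Longrightarrow>
      far F (Comp (S_groupoid A) b a) = Comp (S_groupoid B) (far F b) (far F a)"
    and fob_Nil: "fob F [] = []"
    and fob_append: "xs \<in> lists A \<Longrightarrow> ys \<in> lists A \<Longrightarrow> fob F (xs @ ys) = fob F xs @ fob F ys"
    and far_tens: "a \<in> Arr (S_groupoid A) \<Longrightarrow> b \<in> Arr (S_groupoid A) \<Longrightarrow>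
      far F (tens_ar (S_groupoid A) a b) = tens_ar (S_groupoid B) (far F a) (far F b)"
    and far_symm: "xs \<in> lists A \<Longrightarrow> ys \<in> lists A \<Longrightarrow>
      far F (symm (S_groupoid A) xs ys) = symm (S_groupoid B) (fob F xs) (fob F ys)"

lemma S_functor_ssm_functor:
  assumes F: "ssm_functor G H F" and G: "ssm_eq G (S_groupoid A)" and H: "ssm_eq H (S_groupoid B)"
  shows "S_functor A B F"
proof -
  interpret ssm_functor G H F by (rule F)
  have Obj: "Obj G = lists A" "Obj H = lists B"
    and Arr: "Arr G = Arr (S_groupoid A)" "Arr H = Arr (S_groupoid B)"
    and DC: "\<And>a. a \<in> Arr (S_groupoid A) \<Longrightarrow> Dom G a = Dom (S_groupoid A) a"
      "\<And>a. a \<in> Arr (S_groupoid A) \<Longrightarrow> Cod G a = Cod (S_groupoid A) a"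
      "\<And>a. a \<in> Arr (S_groupoid B) \<Longrightarrow> Dom H a = Dom (S_groupoid B) a"
      "\<And>a. a \<in> Arr (S_groupoid B) \<Longrightarrow> Cod H a = Cod (S_groupoid B) a"
    and Ident: "\<And>x. x \<in> lists A \<Longrightarrow> Ident G x = Ident (S_groupoid A) x"
      "\<And>x. x \<in> lists B \<Longrightarrow> Ident H x = Ident (S_groupoid B) x"
    and Comp: "\<And>b a. composable G b a \<Longrightarrow> Comp G b a = Comp (S_groupoid A) b a"
      "\<And>b a. composable H b a \<Longrightarrow> Comp H b a = Comp (S_groupoid B) b a"
    and unit: "unit_ob G = []" "unit_ob H = []"
    and tens_ob: "\<And>x y. x \<in> lists A \<Longrightarrow> y \<in> lists A \<Longrightarrow> tens_ob G x y = x @ y"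
      "\<And>x y. x \<in> lists B \<Longrightarrow> y \<in> lists B \<Longrightarrow> tens_ob H x y = x @ y"
    and tens_ar: "\<And>a b. a \<in> Arr (S_groupoid A) \<Longrightarrow> b \<in> Arr (S_groupoid A) \<Longrightarrow>
        tens_ar G a b = tens_ar (S_groupoid A) a b"
      "\<And>a b. a \<in> Arr (S_groupoid B) \<Longrightarrow> b \<in> Arr (S_groupoid B) \<Longrightarrow>
        tens_ar H a b = tens_ar (S_groupoid B) a b"
    and symm: "\<And>x y. x \<in> lists A \<Longrightarrow> y \<in> lists A \<Longrightarrow> symm G x y = symm (S_groupoid A) x y"
      "\<And>x y. x \<in> lists B \<Longrightarrow> y \<in> lists B \<Longrightarrow> symm H x y = symm (S_groupoid B) x y"
    using G H by (simp_all add: ssm_eq_def del: split_paired_All)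
  have far: "far F a \<in> Arr (S_groupoid B)" if "a \<in> Arr (S_groupoid A)" for a
    using far_in_hom that by (simp add: in_hom_def Arr)
  have fob: "fob F x \<in> lists B" if "x \<in> lists A" for x
    using fob_Obj that by (simp add: Obj)
  show ?thesis
  proof
    fix a b assume "a \<in> Arr (S_groupoid A)" "b \<in> Arr (S_groupoid A)"
    then show "tens_ar (S_groupoid A) a b \<in> Arr (S_groupoid A)"
      using A.tens_in_hom[of a b] by (simp add: in_hom_def Arr tens_ar)
  next
    fix x y assume "x \<in> lists A" "y \<in> lists A"
    then show "symm (S_groupoid A) x y \<in> Arr (S_groupoid A)"
      using A.symm_in_hom[of x y] by (simp add: in_hom_def Obj Arr symm)
  next
    fix a assume "a \<in> Arr (S_groupoid A)"
    then show "in_hom (S_groupoid B) (far F a) (fob F (Dom (S_groupoid A) a)) (fob F (Cod (S_groupoid A) a))"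
      using far_in_hom[of a] far[of a] by (auto simp: in_hom_def Arr DC)
  next
    fix x assume "x \<in> lists A"
    then show "fob F x \<in> lists B" by (rule fob)
  next
    fix x assume "x \<in> lists A"
    then show "far F (x, id, x) = (fob F x, id, fob F x)"
      using far_Ident[of x] fob[of x] by (simp add: Obj Ident)
  next
    fix b a assume ba: "composable (S_groupoid A) b a"
    then have c: "composable G b a" by (simp add: composable_def Arr DC)
    moreover have "composable H (far F b) (far F a)"
      using c far_in_hom[of a] far_in_hom[of b] by (simp add: composable_def in_hom_def)
    ultimately show "far F (Comp (S_groupoid A) b a) = Comp (S_groupoid B) (far F b) (far F a)"
      using far_Comp[of b a] by (simp add: Comp)
  next
    show "fob F [] = []" using fob_unit by (simp add: unit)
  next
    fix x y assume "x \<in> lists A" "y \<in> lists A"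
    then show "fob F (x @ y) = fob F x @ fob F y"
      using fob_tens[of x y] fob[of x] fob[of y] by (simp add: Obj tens_ob)
  next
    fix a b assume "a \<in> Arr (S_groupoid A)" "b \<in> Arr (S_groupoid A)"
    then show "far F (tens_ar (S_groupoid A) a b) = tens_ar (S_groupoid B) (far F a) (far F b)"
      using far_tens[of a b] far[of a] far[of b] by (simp add: Arr tens_ar)
  next
    fix x y assume "x \<in> lists A" "y \<in> lists A"
    then show "far F (symm (S_groupoid A) x y) = symm (S_groupoid B) (fob F x) (fob F y)"
      using far_symm[of x y] fob[of x] fob[of y] by (simp add: Obj symm)
  qed
qed

context S_functor
begin

lemma fob_concat: "xs \<in> lists A \<Longrightarrow> fob F xs = concat (map (\<lambda>x. fob F [x]) xs)"
proof (induction xs)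
  case Nil
  then show ?case by (simp add: fob_Nil)
next
  case (Cons x xs)
  then show ?case using fob_append[of "[x]" xs] by simp
qed

abbreviation blocks :: "'x list \<Rightarrow> nat list" where
  "blocks xs \<equiv> map (\<lambda>x. length (fob F [x])) xs"

lemma length_fob: "xs \<in> lists A \<Longrightarrow> length (fob F xs) = sum_list (blocks xs)"
  by (subst fob_concat) (simp_all add: length_concat comp_def)

lemma length_fob_eq:
  assumes "(xs, \<rho>, ys) \<in> Arr (S_groupoid A)"
  shows "length (fob F xs) = length (fob F ys)"
proof -
  obtain us \<sigma> vs where "far F (xs, \<rho>, ys) = (us, \<sigma>, vs)" by (metis prod_cases3)
  then show ?thesis using far_in_hom[OF assms] by (auto simp: in_hom_def Arr_S_groupoid_iff)
qed

text \<open>Every arrow of a free symmetric strict monoidal groupoid is built from identities and symmetries: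
  an arrow out of \<open>x # xs\<close> first rearranges \<open>xs\<close> and then moves \<open>x\<close> past the entries \<open>us\<close> that
  precede it in the target.  Induction over the source therefore determines the functor.\<close>
lemma far_eq:
  assumes "(xs, \<rho>, ys) \<in> Arr (S_groupoid A)"
  shows "far F (xs, \<rho>, ys) = (fob F xs, block_perm (blocks xs) (blocks ys) \<rho>, fob F ys)"
  using assms
proof (induction xs arbitrary: \<rho> ys)
  case Nil
  then have "\<rho> = id" "ys = []" by (auto simp: Arr_S_groupoid_iff)
  moreover have "block_perm [] [] id = id" by (simp add: block_perm_def fun_eq_iff)
  ultimately show ?case using far_Ident[of "[]"] by (simp add: id_def)
next
  case (Cons x xs)
  let ?S = "S_groupoid A"
  let ?k = "\<rho> 0" and ?n = "length xs"
  have lists: "x \<in> A" "xs \<in> lists A" "ys \<in> lists A" and len: "length ys = Suc ?n"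
    and \<rho>: "\<rho> permutes {..<Suc ?n}" and nth: "\<And>i. i < Suc ?n \<Longrightarrow> (x # xs) ! i = ys ! \<rho> i"
    using Cons.prems by (auto simp: Arr_S_groupoid_iff)
  have less: "\<rho> i < Suc ?n \<longleftrightarrow> i < Suc ?n" for i
    using permutes_in_image[OF \<rho>, of i] by simp
  have inj: "\<rho> i = \<rho> j \<longleftrightarrow> i = j" for i j
    using permutes_inj[OF \<rho>] by (auto dest: injD)
  have k: "?k < length ys" using less[of 0] len by simp
  define us where "us = take ?k ys"
  define vs where "vs = drop (Suc ?k) ys"
  have ys: "ys = us @ x # vs"
    using id_take_nth_drop[OF k] nth[of 0] by (simp add: us_def vs_def)
  have len_us: "length us = ?k" using k by (simp add: us_def)
  have uv: "us \<in> lists A" "vs \<in> lists A" using lists ys by auto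
  \<comment> \<open>The permutation of \<open>xs\<close> that remains when \<open>x\<close> is removed from source and target.\<close>
  define \<rho>' where "\<rho>' j = (if \<rho> (Suc j) < ?k then \<rho> (Suc j) else \<rho> (Suc j) - 1)" for j
  have gt: "?k < \<rho> (Suc j)" if "\<not> \<rho> (Suc j) < ?k" for j
    using that inj[of 0 "Suc j"] by linarith
  have "\<rho>' permutes {..<?n}"
  proof (rule bij_imp_permutes)
    show "\<rho>' j = j" if "j \<notin> {..<?n}" for j
      using that permutes_not_in[OF \<rho>, of "Suc j"] k len by (simp add: \<rho>'_def)
    have "inj_on \<rho>' {..<?n}"
    proof (rule inj_onI)
      fix i j
      assume "\<rho>' i = \<rho>' j"
      then have "\<rho> (Suc i) = \<rho> (Suc j)"
        using gt[of i] gt[of j] by (auto simp: \<rho>'_def split: if_splits)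
      then show "i = j" by (simp add: inj)
    qed
    moreover have "\<rho>' ` {..<?n} \<subseteq> {..<?n}"
    proof
      fix q assume "q \<in> \<rho>' ` {..<?n}"
      then obtain j where "j < ?n" "q = \<rho>' j" by auto
      then show "q \<in> {..<?n}"
        using less[of "Suc j"] gt[of j] k len by (auto simp: \<rho>'_def)
    qed
    ultimately show "bij_betw \<rho>' {..<?n} {..<?n}"
      by (simp add: bij_betw_def endo_inj_surj)
  qed
  moreover have nth': "xs ! j = (us @ vs) ! \<rho>' j" if "j < ?n" for j
    using that nth[of "Suc j"] gt[of j] by (auto simp: ys nth_append len_us \<rho>'_def nth_Cons')
  ultimately have arr': "(xs, \<rho>', us @ vs) \<in> Arr ?S"
    using lists uv len ys by (simp add: Arr_S_groupoid_iff)
  define a where "a = tens_ar ?S ([x], id, [x]) (xs, \<rho>', us @ vs)"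
  define s where "s = symm ?S [x] us"
  define b where "b = tens_ar ?S s (vs, id, vs)"
  have x1: "([x], id, [x]) \<in> Arr ?S" using lists by (simp add: Arr_S_groupoid_iff permutes_id)
  have vs1: "(vs, id, vs) \<in> Arr ?S" using uv by (simp add: Arr_S_groupoid_iff permutes_id)
  have s_eq: "s = (x # us, \<lambda>i. if i = 0 then ?k else if i \<le> ?k then i - 1 else i, us @ [x])"
    by (auto simp: s_def S_groupoid_def len_us)
  have s1: "s \<in> Arr ?S" unfolding s_def using lists uv by (intro symm_Arr) auto
  have a_eq: "a = (x # xs, \<lambda>i. if i = 0 then 0 else Suc (\<rho>' (i - 1)), x # us @ vs)"
    by (auto simp: a_def S_groupoid_def)
  have b_eq: "b = (x # us @ vs, \<lambda>i. if i = 0 then ?k else if i \<le> ?k then i - 1 else i, us @ x # vs)"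
    by (auto simp: b_def s_eq S_groupoid_def len_us fun_eq_iff)
  have a1: "a \<in> Arr ?S" unfolding a_def by (rule tens_Arr[OF x1 arr'])
  have b1: "b \<in> Arr ?S" unfolding b_def by (rule tens_Arr[OF s1 vs1])
  \<comment> \<open>The values of \<open>b\<close> after \<open>a\<close> at the positions other than the first one.\<close>
  have step: "(if Suc (\<rho>' m) \<le> ?k then \<rho>' m else Suc (\<rho>' m)) = \<rho> (Suc m)" for m
    using gt[of m] by (cases "\<rho> (Suc m) < ?k") (auto simp: \<rho>'_def)
  have "Comp ?S b a = (x # xs, \<rho>, ys)"
    by (auto simp: a_eq b_eq ys fun_eq_iff gr0_conv_Suc simp flip: step)
  then have "far F (x # xs, \<rho>, ys) = far F (Comp ?S b a)" by simp
  also have "\<dots> = Comp (S_groupoid B) (far F b) (far F a)"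
    by (rule far_Comp) (simp add: composable_def a1 b1 S_groupoid_Dom_Cod, simp add: a_eq b_eq)
  also have "far F a = tens_ar (S_groupoid B) (fob F [x], id, fob F [x])
      (fob F xs, block_perm (blocks xs) (blocks (us @ vs)) \<rho>', fob F (us @ vs))"
    unfolding a_def using far_tens[OF x1 arr'] far_Ident[of "[x]"] lists Cons.IH[OF arr'] by simp
  also have "far F b = tens_ar (S_groupoid B) (symm (S_groupoid B) (fob F [x]) (fob F us)) (fob F vs, id, fob F vs)"
    unfolding b_def using far_tens[OF s1 vs1] far_Ident[of vs] far_symm[of "[x]" us] lists uv by (simp add: s_def)
  also have "Comp (S_groupoid B) \<dots> (tens_ar (S_groupoid B) (fob F [x], id, fob F [x])
      (fob F xs, block_perm (blocks xs) (blocks (us @ vs)) \<rho>', fob F (us @ vs))) =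
    (fob F (x # xs), block_perm (blocks (x # xs)) (blocks ys) \<rho>, fob F ys)" 
  proof -
    let ?l = "length (fob F [x])" and ?u = "length (fob F us)"
    \<comment> \<open>The images of \<open>a\<close> and \<open>b\<close> have the underlying permutations \<open>\<tau>\<close> and \<open>\<sigma>\<close>.\<close>
    define \<tau> where "\<tau> i = (if i < ?l then i else ?l + block_perm (blocks xs) (blocks (us @ vs)) \<rho>' (i - ?l))" for i
    define \<sigma> where "\<sigma> i = (if i < ?l then i + ?u else if i < ?l + ?u then i - ?l else i)" for i
    have "\<sigma> (\<tau> m) = block_perm (blocks (x # xs)) (blocks ys) \<rho> m" for m
    proof (cases "m < sum_list (blocks (x # xs))")
      case False
      then have m: "?l + sum_list (blocks xs) \<le> m" by simp
      have "length (fob F (x # xs)) = length (fob F ys)"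
        by (rule length_fob_eq[OF Cons.prems])
      then have "sum_list (blocks (us @ [x] @ vs)) = sum_list (blocks (x # xs))"
        using length_fob[of "x # xs"] length_fob[of ys] lists by (simp add: ys)
      then have "?u \<le> sum_list (blocks xs)" using length_fob[OF uv(1)] by simp
      then show ?thesis using m by (simp add: \<tau>_def \<sigma>_def block_perm_outside)
    next
      case True
      then obtain i c where ic: "i < length (blocks (x # xs))" "c < blocks (x # xs) ! i" "m = offset (blocks (x # xs)) i + c"
        by (rule position_in_block)
      have rhs: "block_perm (blocks (x # xs)) (blocks ys) \<rho> m = offset (blocks ys) (\<rho> i) + c"
        using block_perm_offset[OF ic(1,2)] ic(3) by simp
      show ?thesis
      proof (cases i)
        case 0
        then have "m < ?l" "m = c" using ic by auto
        moreover have "offset (blocks ys) ?k = ?u"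
          using offset_append_right[of "blocks us" "blocks (x # vs)" 0] length_fob[OF uv(1)] len_us
          by (simp add: ys)
        ultimately show ?thesis using rhs 0 by (simp add: \<tau>_def \<sigma>_def)
      next
        case (Suc j)
        then have j: "j < length (blocks xs)" "c < blocks xs ! j" and m: "m = ?l + (offset (blocks xs) j + c)"
          using ic by auto
        have \<tau>m: "\<tau> m = ?l + (offset (blocks (us @ vs)) (\<rho>' j) + c)"
          using block_perm_offset[OF j] by (simp add: \<tau>_def m)
        have u: "?u = offset (blocks (us @ vs)) ?k"
          using offset_append_right[of "blocks us" "blocks vs" 0] length_fob[OF uv(1)] len_us by simp
        show ?thesis
        proof (cases "\<rho> (Suc j) < ?k")
          case True
          then have q: "\<rho>' j = \<rho> (Suc j)" by (simp add: \<rho>'_def)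
          have o: "offset (blocks us @ blocks vs) (\<rho> (Suc j)) = offset (blocks us) (\<rho> (Suc j))"
            "offset (blocks ys) (\<rho> (Suc j)) = offset (blocks us) (\<rho> (Suc j))"
            using True len_us by (simp_all add: ys offset_append_left)
          have "c < blocks us ! \<rho> (Suc j)"
            using j(2) nth'[of j] j(1) True q len_us by (simp add: nth_append)
          then have "offset (blocks us) (\<rho> (Suc j)) + c < ?u"
            using offset_add_less_sum_list[of "\<rho> (Suc j)" "blocks us" c] True len_us length_fob[OF uv(1)] by simp
          then show ?thesis using rhs Suc by (simp add: \<tau>m \<sigma>_def q o)
        next
          case False
          then obtain e where e: "\<rho> (Suc j) = Suc (length us + e)" "\<rho>' j = length us + e"
            using gt[OF False] len_us less_imp_Suc_add by (fastforce simp: \<rho>'_def)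
          have o: "offset (blocks us @ blocks vs) (length us + e) = ?u + offset (blocks vs) e"
            "offset (blocks ys) (Suc (length us + e)) = ?u + (?l + offset (blocks vs) e)"
            using offset_append_right[of "blocks us" "blocks vs" e] length_fob[OF uv(1)]
              offset_append_right[of "blocks us" "blocks (x # vs)" "Suc e"] by (simp_all add: ys)
          show ?thesis using rhs Suc by (simp add: \<tau>m \<sigma>_def e o)
        qed
      qed
    qed
    then have "\<sigma> \<circ> \<tau> = block_perm (blocks (x # xs)) (blocks ys) \<rho>" by (simp add: fun_eq_iff)
    moreover have "tens_ar (S_groupoid B) (fob F [x], id, fob F [x])
      (fob F xs, block_perm (blocks xs) (blocks (us @ vs)) \<rho>', fob F (us @ vs)) =
      (fob F [x] @ fob F xs, \<tau>, fob F [x] @ fob F (us @ vs))"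
      by (simp add: S_groupoid_def \<tau>_def fun_eq_iff)
    moreover have "tens_ar (S_groupoid B) (symm (S_groupoid B) (fob F [x]) (fob F us)) (fob F vs, id, fob F vs) =
      (fob F [x] @ fob F us @ fob F vs, \<sigma>, fob F us @ fob F [x] @ fob F vs)"
      by (auto simp: S_groupoid_def \<sigma>_def fun_eq_iff)
    moreover have "fob F (x # xs) = fob F [x] @ fob F xs" "fob F ys = fob F us @ fob F [x] @ fob F vs"
      using fob_append[of "[x]" xs] fob_append[of us "x # vs"] fob_append[of "[x]" vs] lists uv by (simp_all add: ys)
    ultimately show ?thesis by simp
  qed
  finally show ?case .
qed

lemma far_eq_S_extend:
  assumes "a \<in> Arr (S_groupoid A)"
  shows "far F a = far (S_extend (\<lambda>x. fob F [x])) a"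
proof -
  obtain xs \<rho> ys where a: "a = (xs, \<rho>, ys)" by (metis prod_cases3)
  then have "xs \<in> lists A" "ys \<in> lists A" using assms by (auto simp: Arr_S_groupoid_iff)
  then show ?thesis
    using far_eq assms a fob_concat by (simp add: S_extend_def comp_def)
qed

end

section \<open>Top faces and comparison permutations\<close>

locale shuffle_like_extension =
  category_with_local_terminals C t + X: top_pseudo_simplicial X
  for C :: "('o, 'm) cat" and t :: "'o set \<Rightarrow> 'o"
    and X :: "(('o, 'm) simplex list, ('o, 'm) simplex sarrow) tps" +
  assumes ext: "tsplit_ssm_eq (u_star X) (S_levelwise (N_lt C t))"
    and shuffle: "shuffle_like X"
begin

declare N_lt_set.simps [simp del]

abbreviation N :: "nat \<Rightarrow> ('o, 'm) simplex set" where
  "N \<equiv> N_lt_set C"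

lemma lev_eq: "ssm_eq (lev X r) (S_groupoid (N r))"
  using ext by (simp add: tsplit_ssm_eq_def u_star_def S_levelwise_def N_lt_def)

lemma Obj_lev: "Obj (lev X r) = lists (N r)"
  and Arr_lev: "Arr (lev X r) = Arr (S_groupoid (N r))"
  and Dom_lev: "a \<in> Arr (S_groupoid (N r)) \<Longrightarrow> Dom (lev X r) a = fst a"
  and Cod_lev: "a \<in> Arr (S_groupoid (N r)) \<Longrightarrow> Cod (lev X r) a = snd (snd a)"
  and Ident_lev: "x \<in> lists (N r) \<Longrightarrow> Ident (lev X r) x = (x, id, x)"
  and Comp_lev: "composable (lev X r) b a \<Longrightarrow> Comp (lev X r) b a = Comp (S_groupoid (N r)) b a"
  and unit_lev: "unit_ob (lev X r) = []"
  and tens_ob_lev: "x \<in> lists (N r) \<Longrightarrow> y \<in> lists (N r) \<Longrightarrow> tens_ob (lev X r) x y = x @ y"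
  and tens_ar_lev: "a \<in> Arr (S_groupoid (N r)) \<Longrightarrow> b \<in> Arr (S_groupoid (N r)) \<Longrightarrow>
    tens_ar (lev X r) a b = tens_ar (S_groupoid (N r)) a b"
  using lev_eq[of r] by (simp_all add: ssm_eq_def S_groupoid_Dom_Cod del: split_paired_All)

lemma face_eq: "i < r \<Longrightarrow> ftr_eq (lev X r) (face X r i) (S_map (N_lt_face C i))"
  and deg_eq: "i \<le> r \<Longrightarrow> ftr_eq (lev X r) (deg X r i) (S_map (N_lt_deg C t i))"
  using ext by (simp_all add: tsplit_ssm_eq_def u_star_def S_levelwise_def N_lt_def)

lemma fob_face: "i < r \<Longrightarrow> x \<in> lists (N r) \<Longrightarrow> fob (face X r i) x = map (N_lt_face C i) x"
  and far_face: "i < r \<Longrightarrow> a \<in> Arr (S_groupoid (N r)) \<Longrightarrow>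
    far (face X r i) a = far (S_map (N_lt_face C i)) a"
  using face_eq[of i r] by (simp_all add: ftr_eq_def Obj_lev Arr_lev S_map_def)

lemma fob_deg: "i \<le> r \<Longrightarrow> x \<in> lists (N r) \<Longrightarrow> fob (deg X r i) x = map (N_lt_deg C t i) x"
  using deg_eq[of i r] by (simp add: ftr_eq_def Obj_lev S_map_def)

lemma face_functor: "i \<le> Suc r \<Longrightarrow> S_functor (N (Suc r)) (N r) (face X (Suc r) i)"
  using S_functor_ssm_functor[OF X.face[of i r] lev_eq] lev_eq by simp

lemma N_lt_face_in: "i \<le> r \<Longrightarrow> \<sigma> \<in> N (Suc r) \<Longrightarrow> N_lt_face C i \<sigma> \<in> N r"
  using S_functor.fob_lists[OF face_functor[of i r], of "[\<sigma>]"] fob_face[of i "Suc r" "[\<sigma>]"] by simp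

text \<open>Beyond \<open>u\<^sup>*X\<close>, the structure of \<open>X\<close> is determined on all objects and arrows by the top faces and
  the permutations at generators, which are therefore all that is recorded.\<close>
definition tface :: "nat \<Rightarrow> ('o, 'm) simplex \<Rightarrow> ('o, 'm) simplex list" where
  "tface r \<sigma> = fob (face X r r) [\<sigma>]"

definition perm :: "nat \<Rightarrow> ('o, 'm) simplex \<Rightarrow> nat \<Rightarrow> nat" where
  "perm r \<sigma> = underlying (beta X r [\<sigma>])"

lemma tface_lists: "\<sigma> \<in> N (Suc r) \<Longrightarrow> tface (Suc r) \<sigma> \<in> lists (N r)"
  using S_functor.fob_lists[OF face_functor[of "Suc r" r], of "[\<sigma>]"] by (simp add: tface_def)

lemma tface_nth_in: "\<sigma> \<in> N (Suc r) \<Longrightarrow> i < length (tface (Suc r) \<sigma>) \<Longrightarrow> tface (Suc r) \<sigma> ! i \<in> N r"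
  using tface_lists[of \<sigma> r] by (metis in_listsD nth_mem)

lemma fob_top: "x \<in> lists (N (Suc r)) \<Longrightarrow>
    fob (face X (Suc r) (Suc r)) x = concat (map (tface (Suc r)) x)"
  using S_functor.fob_concat[OF face_functor[of "Suc r" r]] by (simp add: tface_def[abs_def])

lemma far_top: "a \<in> Arr (S_groupoid (N (Suc r))) \<Longrightarrow>
    far (face X (Suc r) (Suc r)) a = far (S_extend (tface (Suc r))) a"
  using S_functor.far_eq_S_extend[OF face_functor[of "Suc r" r]] by (simp add: tface_def[abs_def])

text \<open>The simplicial identities between the top face and the faces that keep the last vertex are strict.
  They are the source of the functoriality of fibres.\<close>
lemma map_face_top:
  assumes "i \<le> r" "\<sigma> \<in> N (Suc (Suc r))"
  shows "map (N_lt_face C i) (tface (Suc (Suc r)) \<sigma>) = tface (Suc r) (N_lt_face C i \<sigma>)"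
proof -
  have "fob (face X (Suc r) i) (fob (face X (Suc (Suc r)) (Suc (Suc r))) [\<sigma>]) =
    fob (face X (Suc r) (Suc r)) (fob (face X (Suc (Suc r)) i) [\<sigma>])"
    using X.face_face[of i "Suc (Suc r)" r] assms by (simp add: ftr_eq_def fcomp_def Obj_lev)
  then show ?thesis
    using assms fob_face[of i "Suc r"] fob_face[of i "Suc (Suc r)" "[\<sigma>]"] tface_lists[of \<sigma> "Suc r"]
    by (simp add: tface_def)
qed

lemma face_top_nth:
  assumes "i \<le> r" "\<sigma> \<in> N (Suc (Suc r))" "j < length (tface (Suc (Suc r)) \<sigma>)"
  shows "N_lt_face C i (tface (Suc (Suc r)) \<sigma> ! j) = tface (Suc r) (N_lt_face C i \<sigma>) ! j"
  using map_face_top[OF assms(1,2)] assms(3) by (metis nth_map)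

text \<open>The fibre of a chain over the chosen local terminal of its component is the chain itself.\<close>
lemma top_deg_top:
  assumes "\<sigma> \<in> N r"
  shows "tface (Suc r) (N_lt_deg C t r \<sigma>) = [\<sigma>]"
proof -
  have "fob (face X (Suc r) (Suc r)) (fob (deg X r r) [\<sigma>]) = [\<sigma>]"
    using X.face_deg_id[of r r "Suc r"] assms by (simp add: ftr_eq_def fcomp_def fid_def Obj_lev)
  then show ?thesis
    using assms fob_deg[of r r "[\<sigma>]"] by (simp add: tface_def)
qed

text \<open>For \<open>r = i = 0\<close> this says that the fibres of an identity are chosen local terminals; for \<open>r = 1\<close> and
  \<open>i = 0\<close>, that fibre maps preserve identities.\<close>
lemma top_deg:
  assumes "i \<le> r" "\<sigma> \<in> N (Suc r)"
  shows "tface (Suc (Suc r)) (N_lt_deg C t i \<sigma>) = map (N_lt_deg C t i) (tface (Suc r) \<sigma>)"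
proof -
  have "fob (face X (Suc (Suc r)) (Suc (Suc r))) (fob (deg X (Suc r) i) [\<sigma>]) =
    fob (deg X r i) (fob (face X (Suc r) (Suc r)) [\<sigma>])"
    using X.face_deg_greater[of i "Suc (Suc r)" r] assms by (simp add: ftr_eq_def fcomp_def Obj_lev)
  then show ?thesis
    using assms fob_deg[of i "Suc r" "[\<sigma>]"] fob_deg[of i r] tface_lists[of \<sigma> r]
    by (simp add: tface_def)
qed

lemma underlying_Comp:
  "underlying (Comp (S_groupoid A) b a) = underlying b \<circ> underlying a"
  by (cases a, cases b) simp

lemma beta_in_hom:
  assumes "x \<in> lists (N (Suc (Suc r)))"
  shows "beta X r x \<in> Arr (S_groupoid (N r))"
    and "fst (beta X r x) = concat (map (tface (Suc r)) (map (N_lt_face C (Suc r)) x))"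
    and "snd (snd (beta X r x)) = concat (map (tface (Suc r)) (concat (map (tface (Suc (Suc r))) x)))"
proof -
  interpret b: invertible_monoidal_transformation "lev X (r + 2)" "lev X r"
      "face X (r + 1) (r + 1) \<odot> face X (r + 2) (r + 1)"
      "face X (r + 1) (r + 1) \<odot> face X (r + 2) (r + 2)" "beta X r"
    by (rule X.beta)
  have tface_in: "y \<in> N (Suc r)" if "\<sigma> \<in> set x" "y \<in> set (tface (Suc (Suc r)) \<sigma>)" for \<sigma> y
    using that assms tface_lists[of \<sigma> "Suc r"] by auto
  have x: "map (N_lt_face C (Suc r)) x \<in> lists (N (Suc r))"
    "concat (map (tface (Suc (Suc r))) x) \<in> lists (N (Suc r))"
    using assms N_lt_face_in[of "Suc r" "Suc r"] by (auto intro: tface_in)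
  show *: "beta X r x \<in> Arr (S_groupoid (N r))"
    using b.in_hom[of x] assms by (simp add: Obj_lev in_hom_def Arr_lev)
  show "fst (beta X r x) = concat (map (tface (Suc r)) (map (N_lt_face C (Suc r)) x))"
    using b.in_hom[of x] assms * x
    by (auto simp: Obj_lev in_hom_def Dom_lev fcomp_def fob_face fob_top)
  show "snd (snd (beta X r x)) = concat (map (tface (Suc r)) (concat (map (tface (Suc (Suc r))) x)))"
    using b.in_hom[of x] assms * x
    by (auto simp: Obj_lev in_hom_def Cod_lev fcomp_def fob_top)
qed

lemma beta_generator:
  assumes "\<sigma> \<in> N (Suc (Suc r))"
  shows "beta X r [\<sigma>] = (tface (Suc r) (N_lt_face C (Suc r) \<sigma>), perm r \<sigma>,
    concat (map (tface (Suc r)) (tface (Suc (Suc r)) \<sigma>)))"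
  using beta_in_hom[of "[\<sigma>]" r] assms by (simp add: perm_def prod_eq_iff)

lemma beta_Nil: "beta X r [] = ([], id, [])"
  using invertible_monoidal_transformation.monoidal_unit[OF X.beta[of r]]
  by (simp add: unit_lev Ident_lev)

lemma beta_append:
  assumes "x \<in> lists (N (Suc (Suc r)))" "y \<in> lists (N (Suc (Suc r)))"
  shows "beta X r (x @ y) = tens_ar (S_groupoid (N r)) (beta X r x) (beta X r y)"
  using invertible_monoidal_transformation.monoidal_tens[OF X.beta[of r], of x y] assms beta_in_hom(1)
  by (simp add: Obj_lev tens_ob_lev tens_ar_lev)

text \<open>The lengths of the blocks into which \<open>\<beta>\<^sub>r\<close> distributes at \<open>\<sigma>\<close>.\<close>
abbreviation sizes :: "nat \<Rightarrow> ('o, 'm) simplex \<Rightarrow> nat list" where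
  "sizes r \<sigma> \<equiv> map (\<lambda>p. length (tface (Suc r) p)) (tface (Suc (Suc r)) \<sigma>)"

lemma length_tface_face:
  assumes "\<sigma> \<in> N (Suc (Suc r))"
  shows "length (tface (Suc r) (N_lt_face C (Suc r) \<sigma>)) = sum_list (sizes r \<sigma>)"
  using beta_in_hom(1)[of "[\<sigma>]" r] assms
  by (simp add: beta_generator Arr_S_groupoid_iff length_concat comp_def)

lemma
  assumes "\<sigma> \<in> N (Suc (Suc r))"
  shows perm_permutes: "perm r \<sigma> permutes {..<sum_list (sizes r \<sigma>)}"
    and perm_nth: "k < sum_list (sizes r \<sigma>) \<Longrightarrow> tface (Suc r) (N_lt_face C (Suc r) \<sigma>) ! k =
      concat (map (tface (Suc r)) (tface (Suc (Suc r)) \<sigma>)) ! perm r \<sigma> k"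
  using beta_in_hom(1)[of "[\<sigma>]" r] assms length_tface_face[of \<sigma> r]
  by (simp_all add: beta_generator Arr_S_groupoid_iff length_concat comp_def)

text \<open>Faces other than the top one relabel entries and do not change permutations, so (b) reduces
  the permutation of \<open>\<beta>\<^sub>r\<^sub>+\<^sub>1\<close> to one of \<open>\<beta>\<^sub>r\<close>.\<close>
lemma perm_face_0:
  assumes "\<sigma> \<in> N (Suc (Suc (Suc r)))"
  shows "perm (Suc r) \<sigma> = perm r (N_lt_face C 0 \<sigma>)"
proof -
  have "far (face X (Suc r) 0) (beta X (Suc r) [\<sigma>]) = beta X r (fob (face X (Suc (Suc (Suc r))) 0) [\<sigma>])"
    using X.beta_b[of 0 r "[\<sigma>]"] assms by (simp add: Obj_lev numeral_3_eq_3)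
  then have "far (S_map (N_lt_face C 0)) (beta X (Suc r) [\<sigma>]) = beta X r [N_lt_face C 0 \<sigma>]"
    using assms beta_in_hom(1)[of "[\<sigma>]" "Suc r"] by (simp add: far_face fob_face)
  then have "underlying (far (S_map (N_lt_face C 0)) (beta X (Suc r) [\<sigma>])) = perm r (N_lt_face C 0 \<sigma>)"
    by (simp add: perm_def)
  then show ?thesis
    by (simp add: S_map_def perm_def split: prod.splits)
qed

lemma shuffle_perm:
  assumes "\<sigma> \<in> N (Suc (Suc r))" "n = sum_list (sizes r \<sigma>)"
    "\<And>j. j < n \<Longrightarrow> g j = block (sizes r \<sigma>) (perm r \<sigma> j)"
  shows "shuffle (sizes r \<sigma>) (perm r \<sigma>) n g"
proof
  show "n = sum_list (sizes r \<sigma>)" "perm r \<sigma> permutes {..<n}"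
    using assms perm_permutes by simp_all
  fix i assume "i < length (sizes r \<sigma>)"
  then show "mono_on {..<sizes r \<sigma> ! i} (\<lambda>a. inv (perm r \<sigma>) (offset (sizes r \<sigma>) i + a))"
    using shuffle assms(1) by (simp add: shuffle_like_def Obj_lev tface_def perm_def Let_def)
qed (use assms in auto)

text \<open>As \<open>\<beta>\<^sub>r\<close> is monoidal, it acts on a list of generators as a block sum.\<close>
lemma underlying_beta_offset:
  assumes "ps \<in> lists (N (Suc (Suc r)))" "i < length ps"
    "a < length (tface (Suc r) (N_lt_face C (Suc r) (ps ! i)))"
  shows "underlying (beta X r ps)
      (offset (map (\<lambda>p. length (tface (Suc r) (N_lt_face C (Suc r) p))) ps) i + a) =
    offset (map (\<lambda>p. length (tface (Suc r) (N_lt_face C (Suc r) p))) ps) i + perm r (ps ! i) a"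
  using assms
proof (induction ps arbitrary: i rule: list.induct)
  case (Cons p ps)
  let ?l = "length (tface (Suc r) (N_lt_face C (Suc r) p))"
  have ps: "p \<in> N (Suc (Suc r))" "ps \<in> lists (N (Suc (Suc r)))"
    using Cons.prems(1) by auto
  obtain us \<rho> vs where b: "beta X r ps = (us, \<rho>, vs)" by (metis prod_cases3)
  have "beta X r (p # ps) = tens_ar (S_groupoid (N r)) (beta X r [p]) (beta X r ps)"
    using beta_append[of "[p]" r ps] ps by simp
  then have u: "underlying (beta X r (p # ps)) k = (if k < ?l then perm r p k else ?l + \<rho> (k - ?l))" for k
    using ps by (simp add: beta_generator b S_groupoid_def)
  show ?case
  proof (cases i)
    case 0
    then show ?thesis using Cons.prems by (simp add: u)
  next
    case (Suc i')
    then show ?thesis using Cons.prems Cons.IH[OF ps(2), of i'] b by (simp add: u)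
  qed
qed simp

text \<open>The coherence (a) on underlying permutations.  On the left the top face is applied to \<open>\<beta>\<^sub>r\<^sub>+\<^sub>1\<close>,
  which makes it a permutation of blocks.\<close>
lemma perm_coherence:
  assumes \<sigma>: "\<sigma> \<in> N (Suc (Suc (Suc r)))"
  shows "block_perm (map (length \<circ> tface (Suc r)) (tface (Suc (Suc r)) (N_lt_face C (Suc (Suc r)) \<sigma>)))
      (map (length \<circ> tface (Suc r)) (concat (map (tface (Suc (Suc r))) (tface (Suc (Suc (Suc r))) \<sigma>))))
      (perm (Suc r) \<sigma>) \<circ> perm r (N_lt_face C (Suc (Suc r)) \<sigma>) =
    underlying (beta X r (tface (Suc (Suc (Suc r))) \<sigma>)) \<circ> perm r (N_lt_face C (Suc r) \<sigma>)"
proof -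
  let ?x = "[\<sigma>]" and ?R = "Suc (Suc (Suc r))"
  let ?a = "far (face X (Suc r) (Suc r)) (beta X (Suc r) ?x)"
  have f: "fob (face X ?R (Suc (Suc r))) ?x = [N_lt_face C (Suc (Suc r)) \<sigma>]"
    "fob (face X ?R (Suc r)) ?x = [N_lt_face C (Suc r) \<sigma>]" "fob (face X ?R ?R) ?x = tface ?R \<sigma>"
    using \<sigma> by (simp_all add: fob_face tface_def)
  have in_N: "N_lt_face C (Suc (Suc r)) \<sigma> \<in> N (Suc (Suc r))" "N_lt_face C (Suc r) \<sigma> \<in> N (Suc (Suc r))"
    using N_lt_face_in[of _ "Suc (Suc r)" \<sigma>] \<sigma> by (simp_all)
  have top_in: "tface ?R \<sigma> \<in> lists (N (Suc (Suc r)))" using tface_lists[OF \<sigma>] .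
  have b1: "beta X (Suc r) ?x \<in> Arr (S_groupoid (N (Suc r)))"
    using beta_in_hom(1)[of ?x "Suc r"] \<sigma> by (simp)
  have a: "in_hom (S_groupoid (N r)) ?a
      (fob (face X (Suc r) (Suc r)) (fst (beta X (Suc r) ?x)))
      (fob (face X (Suc r) (Suc r)) (snd (snd (beta X (Suc r) ?x))))"
    using S_functor.far_in_hom[OF face_functor[of "Suc r" r] b1] by (simp add: S_groupoid_Dom_Cod)
  have left: "composable (lev X r) ?a (beta X r [N_lt_face C (Suc (Suc r)) \<sigma>])"
    using a beta_in_hom[of "[N_lt_face C (Suc (Suc r)) \<sigma>]" r] beta_in_hom(2)[of ?x "Suc r"] in_N \<sigma>
      fob_top[of "tface (Suc (Suc r)) (N_lt_face C (Suc (Suc r)) \<sigma>)" r] tface_lists[OF in_N(1)]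
    by (simp add: composable_def in_hom_def Arr_lev Dom_lev Cod_lev S_groupoid_Dom_Cod)
  have right: "composable (lev X r) (beta X r (tface ?R \<sigma>)) (beta X r [N_lt_face C (Suc r) \<sigma>])"
    using beta_in_hom[of "[N_lt_face C (Suc r) \<sigma>]" r] beta_in_hom[OF top_in] in_N
      map_face_top[of "Suc r" "Suc r" \<sigma>] \<sigma>
    by (simp add: composable_def Arr_lev Dom_lev Cod_lev)
  have "Comp (S_groupoid (N r)) ?a (beta X r [N_lt_face C (Suc (Suc r)) \<sigma>]) =
    Comp (S_groupoid (N r)) (beta X r (tface ?R \<sigma>)) (beta X r [N_lt_face C (Suc r) \<sigma>])"
    using X.beta_a[of ?x r] \<sigma> Comp_lev[OF left] Comp_lev[OF right] f
    by (simp add: Obj_lev numeral_3_eq_3)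
  then have "underlying ?a \<circ> perm r (N_lt_face C (Suc (Suc r)) \<sigma>) =
    underlying (beta X r (tface ?R \<sigma>)) \<circ> perm r (N_lt_face C (Suc r) \<sigma>)"
    using in_N by (simp add: underlying_Comp beta_generator prod_eq_iff)
  moreover have "underlying ?a = block_perm
      (map (length \<circ> tface (Suc r)) (tface (Suc (Suc r)) (N_lt_face C (Suc (Suc r)) \<sigma>)))
      (map (length \<circ> tface (Suc r)) (concat (map (tface (Suc (Suc r))) (tface ?R \<sigma>))))
      (perm (Suc r) \<sigma>)"
    using far_top[OF b1] beta_generator[OF \<sigma>] by (simp add: S_extend_def)
  ultimately show ?thesis by simp
qed

section \<open>Fibres and fibre maps\<close>

text \<open>\<open>Chain (Dom C f) [f, g]\<close> is the chain with the arrow \<open>g\<close> after \<open>f\<close>; the fibre maps of a chain of length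
  two form a single arrow, whence \<open>last_arrow\<close>.\<close>
definition operadic :: "('o, 'm) operadic_data" where
  "operadic = \<lparr>
     card_ob = (\<lambda>x. length (tface (Suc 0) (Chain x []))),
     card_ar = (\<lambda>f. \<lambda>j \<in> {..<length (tface (Suc 0) (Chain (Dom C f) []))}.
       block (sizes 0 (Chain (Dom C f) [f])) (perm 0 (Chain (Dom C f) [f]) j)),
     fib_ob = (\<lambda>g i. case tface (Suc (Suc 0)) (Chain (Dom C g) [g]) ! i of Chain x _ \<Rightarrow> x),
     fib_ar = (\<lambda>g f i. last_arrow (tface (Suc (Suc (Suc 0))) (Chain (Dom C f) [f, g]) ! i))\<rparr>"

abbreviation cardinality where "cardinality \<equiv> card_ob operadic"
abbreviation points_map where "points_map \<equiv> card_ar operadic"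
abbreviation fibre where "fibre \<equiv> fib_ob operadic"
abbreviation fibre_map where "fibre_map \<equiv> fib_ar operadic"

lemma Chain_in_N [simp]: "Chain x fs \<in> N (Suc r) \<longleftrightarrow> is_path C x fs \<and> length fs = r"
  by (auto simp: N_lt_set.simps)

lemma N_Suc_cases:
  assumes "\<sigma> \<in> N (Suc r)"
  obtains x fs where "\<sigma> = Chain x fs" "is_path C x fs" "length fs = r"
  using assms by (auto simp: N_lt_set.simps)

text \<open>Omitting the initial vertices one by one does not change the length of the top face.\<close>
lemma length_tface_Chain:
  assumes "is_path C x fs"
  shows "length (tface (Suc (length fs)) (Chain x fs)) = cardinality (vertex C x fs (length fs))"
  using assms
proof (induction fs arbitrary: x)
  case Nil
  then show ?case by (simp add: operadic_def vertex_def)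
next
  case (Cons f fs)
  have "map (N_lt_face C 0) (tface (Suc (Suc (length fs))) (Chain x (f # fs))) =
    tface (Suc (length fs)) (N_lt_face C 0 (Chain x (f # fs)))"
    using Cons.prems by (intro map_face_top) simp_all
  then have "length (tface (Suc (Suc (length fs))) (Chain x (f # fs))) =
    length (tface (Suc (length fs)) (Chain (Cod C f) fs))"
    by (metis N_lt_face.simps(2) length_map)
  then show ?case using Cons by (simp add: vertex_def nth_Cons')
qed

lemma length_tface_1: "x \<in> Obj C \<Longrightarrow> length (tface (Suc 0) (Chain x [])) = cardinality x"
  using length_tface_Chain[of x "[]"] by (simp add: vertex_def)

lemma length_tface_2: "g \<in> Arr C \<Longrightarrow> length (tface (Suc (Suc 0)) (Chain (Dom C g) [g])) = cardinality (Cod C g)"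
  using length_tface_Chain[of "Dom C g" "[g]"] by (simp add: vertex_def Cod_Obj)

lemma length_tface_3: "composable C g f \<Longrightarrow>
    length (tface (Suc (Suc (Suc 0))) (Chain (Dom C f) [f, g])) = cardinality (Cod C g)"
  using length_tface_Chain[of "Dom C f" "[f, g]"] by (simp add: vertex_def Cod_Obj composable_def)

lemma length_tface_4: "composable C g f \<Longrightarrow> composable C f h \<Longrightarrow>
    length (tface (Suc (Suc (Suc (Suc 0)))) (Chain (Dom C h) [h, f, g])) = cardinality (Cod C g)"
  using length_tface_Chain[of "Dom C h" "[h, f, g]"] by (simp add: vertex_def Cod_Obj composable_def)

lemma tface_2_nth:
  assumes "g \<in> Arr C" "i < cardinality (Cod C g)"
  shows "tface (Suc (Suc 0)) (Chain (Dom C g) [g]) ! i = Chain (fibre g i) []"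
    and "fibre g i \<in> Obj C"
proof -
  have "tface (Suc (Suc 0)) (Chain (Dom C g) [g]) ! i \<in> N (Suc 0)"
    using assms by (intro tface_nth_in) (simp_all add: length_tface_2 Cod_Obj)
  then obtain x where x: "tface (Suc (Suc 0)) (Chain (Dom C g) [g]) ! i = Chain x []" "x \<in> Obj C"
    by (elim N_Suc_cases) auto
  then show "tface (Suc (Suc 0)) (Chain (Dom C g) [g]) ! i = Chain (fibre g i) []" "fibre g i \<in> Obj C"
    by (simp_all add: operadic_def)
qed

lemma Comp_arrow:
  assumes "composable C g f"
  shows "Comp C g f \<in> Arr C" "Dom C (Comp C g f) = Dom C f" "Cod C (Comp C g f) = Cod C g"
  using Comp_in_hom[OF assms] by (simp_all add: in_hom_def)

text \<open>The faces \<open>d\<^sub>0\<close> and \<open>d\<^sub>1\<close> compute target and source of the fibre map.\<close>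
lemma tface_3_nth:
  assumes gf: "composable C g f" and i: "i < cardinality (Cod C g)"
  shows "tface (Suc (Suc (Suc 0))) (Chain (Dom C f) [f, g]) ! i =
      Chain (fibre (Comp C g f) i) [fibre_map g f i]"
    and "in_hom C (fibre_map g f i) (fibre (Comp C g f) i) (fibre g i)"
proof -
  let ?\<sigma> = "Chain (Dom C f) [f, g]"
  have g: "g \<in> Arr C" "f \<in> Arr C" "Dom C g = Cod C f" using gf by (auto simp: composable_def)
  have \<sigma>: "?\<sigma> \<in> N (Suc (Suc (Suc 0)))" using g by (simp add: Cod_Obj)
  have len: "i < length (tface (Suc (Suc (Suc 0))) ?\<sigma>)" using i length_tface_3[OF gf] by simp
  have "tface (Suc (Suc (Suc 0))) ?\<sigma> ! i \<in> N (Suc (Suc 0))"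
    using \<sigma> len by (rule tface_nth_in)
  then obtain x a where x: "tface (Suc (Suc (Suc 0))) ?\<sigma> ! i = Chain x [a]" "is_path C x [a]"
    by (elim N_Suc_cases) (auto simp: length_Suc_conv)
  then have a: "a = fibre_map g f i" by (simp add: operadic_def last_arrow_def)
  have "Chain (Cod C a) [] = tface (Suc (Suc 0)) (Chain (Dom C g) [g]) ! i"
    using face_top_nth[OF _ \<sigma> len, of 0] x g by simp
  then have "Cod C a = fibre g i" using tface_2_nth[OF g(1) i] by simp
  moreover have "Chain x [] = tface (Suc (Suc 0)) (Chain (Dom C f) [Comp C g f]) ! i"
    using face_top_nth[OF _ \<sigma> len, of "Suc 0"] x g by simp
  then have "x = fibre (Comp C g f) i"
    using tface_2_nth[of "Comp C g f" i] Comp_arrow[OF gf] i by simp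
  ultimately show "tface (Suc (Suc (Suc 0))) (Chain (Dom C f) [f, g]) ! i =
      Chain (fibre (Comp C g f) i) [fibre_map g f i]"
    "in_hom C (fibre_map g f i) (fibre (Comp C g f) i) (fibre g i)"
    using x a by (auto simp: in_hom_def)
qed

text \<open>The \<open>i\<close>-th entry is a chain of two arrows.  Its faces \<open>d\<^sub>0\<close> and \<open>d\<^sub>2\<close> identify these two arrows, and
  \<open>d\<^sub>1\<close> then says that fibre maps compose.\<close>
lemma tface_4_nth:
  assumes gf: "composable C g f" and fh: "composable C f h" and i: "i < cardinality (Cod C g)"
  shows "tface (Suc (Suc (Suc (Suc 0)))) (Chain (Dom C h) [h, f, g]) ! i =
      Chain (fibre (Comp C (Comp C g f) h) i) [fibre_map (Comp C g f) h i, fibre_map g f i]"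
    and "fibre_map g (Comp C f h) i = Comp C (fibre_map g f i) (fibre_map (Comp C g f) h i)"
proof -
  let ?\<sigma> = "Chain (Dom C h) [h, f, g]"
  have g: "g \<in> Arr C" "f \<in> Arr C" "h \<in> Arr C" "Dom C g = Cod C f" "Dom C f = Cod C h"
    using gf fh by (auto simp: composable_def)
  have c: "composable C (Comp C g f) h" "composable C g (Comp C f h)"
    using Comp_arrow[OF gf] Comp_arrow[OF fh] g by (simp_all add: composable_def)
  have \<sigma>: "?\<sigma> \<in> N (Suc (Suc (Suc (Suc 0))))" using g by (simp add: Cod_Obj)
  have len: "i < length (tface (Suc (Suc (Suc (Suc 0)))) ?\<sigma>)" using i length_tface_4[OF gf fh] by simp
  have "tface (Suc (Suc (Suc (Suc 0)))) ?\<sigma> ! i \<in> N (Suc (Suc (Suc 0)))"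
    using \<sigma> len by (rule tface_nth_in)
  then obtain x a b where x: "tface (Suc (Suc (Suc (Suc 0)))) ?\<sigma> ! i = Chain x [a, b]" "is_path C x [a, b]"
    by (elim N_Suc_cases) (auto simp: length_Suc_conv)
  have "Chain (Cod C a) [b] = tface (Suc (Suc (Suc 0))) (Chain (Dom C f) [f, g]) ! i"
    using face_top_nth[OF _ \<sigma> len, of 0] x g by simp
  then have b: "b = fibre_map g f i" using tface_3_nth[OF gf i] by simp
  have "Chain x [a] = tface (Suc (Suc (Suc 0))) (Chain (Dom C h) [h, Comp C g f]) ! i"
    using face_top_nth[OF _ \<sigma> len, of "Suc (Suc 0)"] x g by simp
  then have xa: "x = fibre (Comp C (Comp C g f) h) i" "a = fibre_map (Comp C g f) h i"
    using tface_3_nth[OF c(1), of i] Comp_arrow[OF gf] i by simp_all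
  have "Chain x [Comp C b a] = tface (Suc (Suc (Suc 0))) (Chain (Dom C h) [Comp C f h, g]) ! i"
    using face_top_nth[OF _ \<sigma> len, of "Suc 0"] x g by simp
  then show "fibre_map g (Comp C f h) i = Comp C (fibre_map g f i) (fibre_map (Comp C g f) h i)"
    using tface_3_nth[OF c(2) i] Comp_arrow[OF fh] b xa by simp
  show "tface (Suc (Suc (Suc (Suc 0)))) (Chain (Dom C h) [h, f, g]) ! i =
      Chain (fibre (Comp C (Comp C g f) h) i) [fibre_map (Comp C g f) h i, fibre_map g f i]"
    using x b xa by simp
qed

lemma fibre_map_Ident:
  assumes g: "g \<in> Arr C" and i: "i < cardinality (Cod C g)"
  shows "fibre_map g (Ident C (Dom C g)) i = Ident C (fibre g i)"
proof -
  have I: "in_hom C (Ident C (Dom C g)) (Dom C g) (Dom C g)" using g by (intro Ident_in_hom Dom_Obj)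
  then have c: "composable C g (Ident C (Dom C g))" using g by (simp add: composable_def in_hom_def)
  have "tface (Suc (Suc (Suc 0))) (N_lt_deg C t 0 (Chain (Dom C g) [g])) =
    map (N_lt_deg C t 0) (tface (Suc (Suc 0)) (Chain (Dom C g) [g]))"
    using g by (intro top_deg) (simp_all add: Cod_Obj)
  then have "tface (Suc (Suc (Suc 0))) (Chain (Dom C g) [Ident C (Dom C g), g]) ! i =
    Chain (fibre g i) [Ident C (fibre g i)]"
    using i length_tface_2[OF g] tface_2_nth[OF g i] by (simp add: vertex_def)
  then show ?thesis
    using tface_3_nth(1)[OF c i] I g by (simp add: in_hom_def Comp_Ident_right)
qed

lemma fibre_to_terminal:
  assumes "x \<in> Obj C"
  shows "tface (Suc (Suc 0)) (Chain x [to_terminal C t x]) = [Chain x []]"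
  using top_deg_top[of "Chain x []" "Suc 0"] assms by (simp add: vertex_def)

lemma fibre_map_to_terminal:
  assumes "g \<in> Arr C"
  shows "tface (Suc (Suc (Suc 0))) (Chain (Dom C g) [g, to_terminal C t (Cod C g)]) = [Chain (Dom C g) [g]]"
  using top_deg_top[of "Chain (Dom C g) [g]" "Suc (Suc 0)"] assms by (simp add: vertex_def Cod_Obj)

lemma component_refl: "x \<in> Obj C \<Longrightarrow> x \<in> component C x"
  by (simp add: component_def)

lemma component_eq:
  assumes "y \<in> component C x"
  shows "component C y = component C x"
proof -
  let ?r = "{(u, v). \<exists>f. in_hom C f u v \<or> in_hom C f v u}"
  have "sym ?r" by (auto simp: sym_def)
  then have "sym (?r\<^sup>*)" by (rule sym_rtrancl)
  moreover have "(x, y) \<in> ?r\<^sup>*" using assms by (simp add: component_def)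
  ultimately show ?thesis
    unfolding component_def by (auto dest: symD intro: rtrancl_trans)
qed

lemma component_t: "c \<in> components C \<Longrightarrow> component C (t c) = c"
  using t_in component_eq by (auto simp: components_def)

lemma to_terminal_in_hom:
  assumes "x \<in> Obj C"
  shows "in_hom C (to_terminal C t x) x (t (component C x))"
proof -
  let ?c = "component C x"
  have c: "?c \<in> components C" using assms by (simp add: components_def)
  then have "\<exists>!f. in_hom C f x (t ?c)"
    using t_terminal[OF c] component_refl[OF assms] component_t[OF c] by (simp add: local_terminal_def)
  then show ?thesis unfolding to_terminal_def by (rule theI')
qed

lemma t_Obj: "c \<in> components C \<Longrightarrow> t c \<in> Obj C"
  using t_terminal by (simp add: local_terminal_def)

lemma tface_t:
  assumes "c \<in> components C"
  shows "tface (Suc 0) (Chain (t c) []) = [Comp0 c]"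
  using top_deg_top[of "Comp0 c" 0] assms by (simp add: N_lt_set.simps)

lemma cardinality_t: "c \<in> components C \<Longrightarrow> cardinality (t c) = 1"
  using tface_t length_tface_1[OF t_Obj, of c] by simp

lemma fibre_to_terminal_0:
  assumes x: "x \<in> Obj C" shows "fibre (to_terminal C t x) 0 = x"
proof -
  have "component C x \<in> components C" using x by (simp add: components_def)
  then show ?thesis
    using tface_2_nth[of "to_terminal C t x" 0] to_terminal_in_hom[OF x] fibre_to_terminal[OF x] cardinality_t
    by (simp add: in_hom_def)
qed

lemma fibre_map_to_terminal_0:
  assumes g: "g \<in> Arr C" shows "fibre_map (to_terminal C t (Cod C g)) g 0 = g"
proof -
  let ?x = "Cod C g"
  have x: "?x \<in> Obj C" using g by (rule Cod_Obj)
  then have "component C ?x \<in> components C" by (simp add: components_def)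
  then show ?thesis
    using tface_3_nth[of "to_terminal C t ?x" g 0] to_terminal_in_hom[OF x] fibre_map_to_terminal[OF g] cardinality_t g
    by (simp add: in_hom_def composable_def)
qed

lemma tface_1_nth:
  assumes "x \<in> Obj C" "i < cardinality x"
  obtains c where "c \<in> components C" "tface (Suc 0) (Chain x []) ! i = Comp0 c"
    "fibre (Ident C x) i = t c"
proof -
  have "tface (Suc 0) (Chain x []) ! i \<in> N 0"
    using assms by (intro tface_nth_in) (simp_all add: length_tface_1)
  then obtain c where c: "c \<in> components C" "tface (Suc 0) (Chain x []) ! i = Comp0 c"
    by (auto simp: N_lt_set.simps)
  have I: "in_hom C (Ident C x) x x" using assms by (intro Ident_in_hom)
  have "tface (Suc (Suc 0)) (N_lt_deg C t 0 (Chain x [])) = map (N_lt_deg C t 0) (tface (Suc 0) (Chain x []))"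
    using assms by (intro top_deg) simp_all
  then have "tface (Suc (Suc 0)) (Chain x [Ident C x]) ! i = Chain (t c) []"
    using c assms by (simp add: vertex_def length_tface_1)
  then have "fibre (Ident C x) i = t c"
    using tface_2_nth[of "Ident C x" i] I assms by (simp add: in_hom_def)
  then show ?thesis using that c by blast
qed

section \<open>The cardinality functor\<close>

lemma map_sizes:
  assumes "g \<in> Arr C"
  shows "sizes 0 (Chain (Dom C g) [g]) = map (\<lambda>i. cardinality (fibre g i)) [0..<cardinality (Cod C g)]"
  by (rule nth_equalityI) (simp_all add: assms length_tface_2 tface_2_nth length_tface_1)

lemma sum_sizes:
  assumes "g \<in> Arr C"
  shows "sum_list (sizes 0 (Chain (Dom C g) [g])) = cardinality (Dom C g)"
  using length_tface_face[of "Chain (Dom C g) [g]" 0] assms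
  by (simp add: Cod_Obj Dom_Obj length_tface_1)

text \<open>The permutation of \<open>\<beta>\<^sub>0\<close> at \<open>g\<close> distributes the points of the source of \<open>g\<close> over the fibres of \<open>g\<close>.\<close>
lemma shuffle_arrow:
  assumes "g \<in> Arr C"
  shows "shuffle (map (\<lambda>i. cardinality (fibre g i)) [0..<cardinality (Cod C g)]) (perm 0 (Chain (Dom C g) [g]))
    (cardinality (Dom C g)) (points_map g)"
proof -
  have "shuffle (sizes 0 (Chain (Dom C g) [g])) (perm 0 (Chain (Dom C g) [g])) (cardinality (Dom C g)) (points_map g)"
  proof (rule shuffle_perm)
    show "Chain (Dom C g) [g] \<in> N (Suc (Suc 0))" using assms by (simp add: Cod_Obj)
    show "cardinality (Dom C g) = sum_list (sizes 0 (Chain (Dom C g) [g]))" using sum_sizes[OF assms] by simp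
    show "points_map g j = block (sizes 0 (Chain (Dom C g) [g])) (perm 0 (Chain (Dom C g) [g]) j)"
      if "j < cardinality (Dom C g)" for j
      using that by (simp add: operadic_def)
  qed
  then show ?thesis by (simp add: map_sizes[OF assms])
qed

text \<open>The point \<open>j\<close> is the \<open>a\<close>-th point of its fibre.\<close>
lemma points_map_position:
  assumes g: "g \<in> Arr C" and j: "j < cardinality (Dom C g)"
  obtains a where "points_map g j < cardinality (Cod C g)" "a < cardinality (fibre g (points_map g j))"
    "perm 0 (Chain (Dom C g) [g]) j = offset (map (\<lambda>i. cardinality (fibre g i)) [0..<cardinality (Cod C g)]) (points_map g j) + a"
    "F_eps (cardinality (Dom C g)) (points_map g) (points_map g j) a = j"
proof -
  interpret shuffle "map (\<lambda>i. cardinality (fibre g i)) [0..<cardinality (Cod C g)]" "perm 0 (Chain (Dom C g) [g])"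
    "cardinality (Dom C g)" "points_map g"
    using g by (rule shuffle_arrow)
  let ?ns = "map (\<lambda>i. cardinality (fibre g i)) [0..<cardinality (Cod C g)]"
  have "perm 0 (Chain (Dom C g) [g]) j < sum_list ?ns" using less[OF j] n by simp
  then obtain i a where ia: "i < length ?ns" "a < ?ns ! i" "perm 0 (Chain (Dom C g) [g]) j = offset ?ns i + a"
    by (rule position_in_block)
  then have "points_map g j = i" using g[OF j] block_offset[OF ia(1,2)] by simp
  moreover have "F_eps (cardinality (Dom C g)) (points_map g) i a = j" using ia by (intro eps_eq) auto
  ultimately show ?thesis using that[of a] ia by simp
qed

lemma points_map_hom: "g \<in> Arr C \<Longrightarrow> points_map g \<in> F_hom (cardinality (Dom C g)) (cardinality (Cod C g))"
  unfolding F_hom_def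
proof (rule PiE_I)
  fix j assume "g \<in> Arr C" "j \<in> {..<cardinality (Dom C g)}"
  then show "points_map g j \<in> {..<cardinality (Cod C g)}" by (auto elim: points_map_position[of g j])
next
  fix j assume "g \<in> Arr C" "j \<notin> {..<cardinality (Dom C g)}"
  then show "points_map g j = undefined" by (simp add: operadic_def)
qed

lemma cardinality_fibre:
  assumes g: "g \<in> Arr C" and i: "i < cardinality (Cod C g)"
  shows "cardinality (fibre g i) = F_fib (cardinality (Dom C g)) (points_map g) i"
  using shuffle.F_fib[OF shuffle_arrow[OF g], of i] i by simp

text \<open>Let \<open>f : T \<rightarrow> S\<close> and \<open>g : S \<rightarrow> R\<close>.  The coherence (a) at \<open>(f, g)\<close> says that a point \<open>x\<close> of \<open>T\<close> ends up in the
  same place in the disjoint union of all fibres of all fibre maps, whether it is sent there by first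
  distributing it to a fibre of \<open>f\<close> and then moving that fibre, or by first distributing it to a fibre
  of \<open>g f\<close> and then applying \<open>\<beta>\<^sub>0\<close> of the fibre map.  Positions in a list of lists of blocks are unique,
  so the outer indices agree, which is functoriality of the cardinality, and so do the inner indices,
  which determine the maps underlying the fibre maps.  The last statement holds since
  the arrow \<open>\<beta>\<^sub>1\<close> at \<open>(f, g)\<close> only permutes the fibres of \<open>f\<close>.\<close>
lemma
  assumes gf: "composable C g f"
  shows points_map_Comp: "x < cardinality (Dom C f) \<Longrightarrow> points_map (Comp C g f) x = points_map g (points_map f x)"
    and fibre_map_eps: "i < cardinality (Cod C g) \<Longrightarrow> a < cardinality (fibre (Comp C g f) i) \<Longrightarrow>
      points_map (fibre_map g f i) a < cardinality (fibre g i) \<and>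
      F_eps (cardinality (Dom C g)) (points_map g) i (points_map (fibre_map g f i) a) =
        points_map f (F_eps (cardinality (Dom C f)) (points_map (Comp C g f)) i a)"
    and fibre_fibre_map: "i < cardinality (Cod C g) \<Longrightarrow> j < cardinality (fibre g i) \<Longrightarrow>
      fibre (fibre_map g f i) j = fibre f (F_eps (cardinality (Dom C g)) (points_map g) i j)"
proof -
  let ?h = "Comp C g f"
  let ?\<sigma> = "Chain (Dom C f) [f, g]"
  have g: "g \<in> Arr C" "f \<in> Arr C" "Cod C f = Dom C g" using gf by (auto simp: composable_def)
  note h = Comp_arrow[OF gf]
  have \<sigma>: "?\<sigma> \<in> N (Suc (Suc (Suc 0)))" using g by (simp add: Cod_Obj flip: g(3))
  \<comment> \<open>\<open>p i\<close> is the \<open>i\<close>-th fibre map as a generator; \<open>ns\<close>, \<open>Ns\<close>, \<open>ls\<close> and \<open>L i\<close> are the sizes of the fibres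
    of \<open>g\<close>, of \<open>g f\<close>, of \<open>f\<close> and of \<open>p i\<close>.\<close>
  define k where "k = cardinality (Cod C g)"
  define m where "m = cardinality (Dom C g)"
  define p where "p i = Chain (fibre ?h i) [fibre_map g f i]" for i
  define ns where "ns = map (\<lambda>i. cardinality (fibre g i)) [0..<k]"
  define Ns where "Ns = map (\<lambda>i. cardinality (fibre ?h i)) [0..<k]"
  define L where "L i = map (\<lambda>j. cardinality (fibre (fibre_map g f i) j)) [0..<cardinality (fibre g i)]" for i
  define Ls where "Ls = map L [0..<k]"
  define ls where "ls = map (\<lambda>j. cardinality (fibre f j)) [0..<m]"
  interpret sg: shuffle ns "perm 0 (Chain (Dom C g) [g])" m "points_map g"
    unfolding ns_def k_def m_def using g by (intro shuffle_arrow)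
  interpret sf: shuffle ls "perm 0 (Chain (Dom C f) [f])" "cardinality (Dom C f)" "points_map f"
    unfolding ls_def m_def using shuffle_arrow[OF g(2)] g by simp
  interpret sh: shuffle Ns "perm 0 (Chain (Dom C f) [?h])" "cardinality (Dom C f)" "points_map ?h"
    unfolding Ns_def k_def using shuffle_arrow[OF h(1)] h by simp
  have a_hom: "fibre_map g f i \<in> Arr C" "Dom C (fibre_map g f i) = fibre ?h i" "Cod C (fibre_map g f i) = fibre g i"
    if "i < k" for i using tface_3_nth(2)[OF gf, of i] that by (simp_all add: in_hom_def k_def)
  have t3: "tface (Suc (Suc (Suc 0))) ?\<sigma> = map p [0..<k]"
    by (rule nth_equalityI) (simp_all add: length_tface_3[OF gf] tface_3_nth[OF gf] k_def p_def)
  have t2p: "tface (Suc (Suc 0)) (p i) = map (\<lambda>j. Chain (fibre (fibre_map g f i) j) []) [0..<cardinality (fibre g i)]"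
    if "i < k" for i
    using a_hom[OF that] length_tface_2[of "fibre_map g f i"] tface_2_nth(1)[of "fibre_map g f i"]
    by (intro nth_equalityI) (simp_all add: p_def)
  have t2f: "tface (Suc (Suc 0)) (Chain (Dom C f) [f]) = map (\<lambda>j. Chain (fibre f j) []) [0..<m]"
    by (rule nth_equalityI) (simp_all add: length_tface_2 tface_2_nth g m_def)
  have fib_Obj: "fibre f j \<in> Obj C" if "j < m" for j
    using tface_2_nth(2)[OF g(2), of j] that g by (simp add: m_def)
  have fibfib_Obj: "fibre (fibre_map g f i) j \<in> Obj C" if "i < k" "j < cardinality (fibre g i)" for i j
    using tface_2_nth(2)[of "fibre_map g f i" j] a_hom[of i] that by simp
  have len_ls: "map (length \<circ> tface (Suc 0)) (tface (Suc (Suc 0)) (Chain (Dom C f) [f])) = ls"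
    by (rule nth_equalityI) (simp_all add: t2f ls_def length_tface_1 fib_Obj)
  have len_L: "map (length \<circ> tface (Suc 0)) (tface (Suc (Suc 0)) (p i)) = L i" if "i < k" for i
    using that by (intro nth_equalityI) (simp_all add: t2p L_def length_tface_1 fibfib_Obj)
  have len_Ls: "map (length \<circ> tface (Suc 0)) (concat (map (tface (Suc (Suc 0))) (map p [0..<k]))) = concat Ls"
    by (auto simp: map_concat Ls_def len_L intro!: arg_cong[where f = concat])
  have map_length_Ls: "map length Ls = ns" by (simp add: Ls_def ns_def L_def)
  have sum_L: "sum_list (L i) = cardinality (fibre ?h i)" if "i < k" for i
    using sum_sizes[of "fibre_map g f i"] map_sizes[of "fibre_map g f i"] a_hom[OF that] by (simp add: L_def)
  have map_sum_Ls: "map sum_list Ls = Ns" by (simp add: Ls_def Ns_def sum_L)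
  have perm1: "perm (Suc 0) ?\<sigma> = perm 0 (Chain (Dom C g) [g])"
    using perm_face_0[OF \<sigma>] g by simp
  have face1_p: "length (tface (Suc 0) (N_lt_face C (Suc 0) (p i))) = cardinality (fibre ?h i)" if "i < k" for i
    using tface_2_nth(2)[of ?h i] h that by (simp add: p_def length_tface_1 k_def)

  have coh: "block_perm ls (concat Ls) (perm 0 (Chain (Dom C g) [g])) (perm 0 (Chain (Dom C f) [f]) x) =
     underlying (beta X 0 (map p [0..<k])) (perm 0 (Chain (Dom C f) [?h]) x)" for x
    using fun_cong[OF perm_coherence[OF \<sigma>], of x] by (simp add: perm1 t3 len_ls flip: len_Ls)
  have ub: "underlying (beta X 0 (map p [0..<k])) (offset Ns i + a) = offset Ns i + perm 0 (p i) a"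
    if "i < k" "a < Ns ! i" for i a
  proof -
    have ps: "map p [0..<k] \<in> lists (N (Suc (Suc 0)))" using tface_lists[OF \<sigma>] t3 by simp
    have lengths: "map (\<lambda>q. length (tface (Suc 0) (N_lt_face C (Suc 0) q))) (map p [0..<k]) = Ns"
      by (simp add: Ns_def face1_p)
    have "i < length (map p [0..<k])"
      "a < length (tface (Suc 0) (N_lt_face C (Suc 0) (map p [0..<k] ! i)))"
      using that face1_p[of i] by (simp_all add: Ns_def)
    from underlying_beta_offset[OF ps this] show ?thesis
      unfolding lengths using that(1) by simp
  qed

  have match: "fibre (fibre_map g f i) j' = fibre f j"
    if i: "i < k" and j': "j' < cardinality (fibre g i)" and j: "j = F_eps m (points_map g) i j'" for i j' j
  proof -
    have ij: "i < length ns" "j' < ns ! i" using i j' by (simp_all add: ns_def)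
    have "j < m" "perm 0 (Chain (Dom C g) [g]) j = offset ns i + j'"
      using sg.eps_less[OF ij] sg.perm_eps[OF ij] j by simp_all
    have "length (tface (Suc (Suc 0)) (Chain (Dom C f) [f])) = sum_list (sizes (Suc 0) ?\<sigma>)"
      using length_tface_face[OF \<sigma>] by simp
    then have "tface (Suc (Suc 0)) (Chain (Dom C f) [f]) ! j =
        concat (map (tface (Suc (Suc 0))) (map p [0..<k])) ! (offset ns i + j')"
      using perm_nth[OF \<sigma>, of j] \<open>j < m\<close> \<open>perm 0 (Chain (Dom C g) [g]) j = offset ns i + j'\<close>
      by (simp add: perm1 t3 t2f)
    also have "map (tface (Suc (Suc 0))) (map p [0..<k]) =
        map (\<lambda>i. map (\<lambda>j. Chain (fibre (fibre_map g f i) j) []) [0..<cardinality (fibre g i)]) [0..<k]"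
      (is "_ = ?xss") by (simp add: t2p)
    also have "concat ?xss ! (offset ns i + j') = ?xss ! i ! j'"
    proof -
      have "map length ?xss = ns" by (simp add: ns_def)
      then show ?thesis using nth_concat_offset[of i ?xss j'] i j' by simp
    qed
    finally show ?thesis using i j' \<open>j < m\<close> by (simp add: t2f)
  qed

  \<comment> \<open>The point \<open>x\<close> of \<open>T\<close> lies over \<open>j\<close>, which is the \<open>j'\<close>-th point of the fibre of \<open>g\<close> over \<open>i\<close>; it is the
    \<open>a\<close>-th point of its fibre under \<open>g f\<close>.\<close>
  have main: "points_map ?h x = i \<and> points_map (fibre_map g f i) a = j'"
    if x: "x < cardinality (Dom C f)" and j: "j = points_map f x" and i: "i = points_map g j"
      and j': "F_eps m (points_map g) i j' = j" "j' < cardinality (fibre g i)"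
      and a: "F_eps (cardinality (Dom C f)) (points_map ?h) (points_map ?h x) a = x" "a < cardinality (fibre ?h (points_map ?h x))"
    for x j i j' a
  proof -
    obtain b where b: "points_map f x < cardinality (Cod C f)" "b < cardinality (fibre f (points_map f x))"
      "perm 0 (Chain (Dom C f) [f]) x = offset (map (\<lambda>i. cardinality (fibre f i)) [0..<cardinality (Cod C f)]) (points_map f x) + b"
      using points_map_position[OF g(2) x] by metis
    then have jm: "j < m" and pf: "perm 0 (Chain (Dom C f) [f]) x = offset ls j + b"
      and bj: "j < length ls" "b < ls ! j"
      using j g by (simp_all add: m_def ls_def)
    have ik: "i < k" using points_map_position[OF g(1), of j] jm i by (auto simp: m_def k_def)
    have pg: "perm 0 (Chain (Dom C g) [g]) j = offset ns i + j'"
      using sg.perm_eps[of i j'] ik j' by (simp add: ns_def)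
    have bL: "b < L i ! j'"
      using match[OF ik j'(2) j'(1)[symmetric]] b(2) j'(2) j by (simp add: L_def)
    have hk: "points_map ?h x < k" using points_map_position[OF h(1), of x] x h(2,3) by (auto simp: k_def)
    have ph: "perm 0 (Chain (Dom C f) [?h]) x = offset Ns (points_map ?h x) + a"
      using sh.perm_eps[of "points_map ?h x" a] hk a by (simp add: Ns_def)
    have sp: "shuffle (L i) (perm 0 (p i)) (cardinality (fibre ?h i)) (points_map (fibre_map g f i))" if "i < k" for i
      using shuffle_arrow[of "fibre_map g f i"] a_hom[OF that] by (simp add: L_def p_def)
    have "offset (concat Ls) (offset ns i + j') = offset Ns i + offset (L i) j'"
      using offset_concat[of i Ls j'] ik j'(2) by (simp add: map_length_Ls map_sum_Ls) (simp add: Ls_def L_def)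
    \<comment> \<open>The two places of \<open>x\<close>: the left-hand side goes through the fibres of \<open>f\<close>, where \<open>x\<close> has
      position \<open>b\<close>, the right-hand side through the fibres of \<open>g f\<close>.\<close>
    then have "offset Ns i + (offset (L i) j' + b) =
      offset Ns (points_map ?h x) + perm 0 (p (points_map ?h x)) a"
      using coh[of x] block_perm_offset[OF bj] ub[OF hk] a hk by (simp add: pf pg ph Ns_def)
    moreover have length_Ns: "length Ns = k" by (simp add: Ns_def)
    moreover have "offset (L i) j' + b < Ns ! i"
      using offset_add_less_sum_list[of j' "L i" b] bL j'(2) ik sum_L[OF ik] by (simp add: L_def Ns_def)
    moreover have "perm 0 (p (points_map ?h x)) a < Ns ! points_map ?h x"
      using shuffle.less[OF sp[OF hk] a(2)] hk by (simp add: Ns_def)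
    ultimately have eq: "i = points_map ?h x" "offset (L i) j' + b = perm 0 (p (points_map ?h x)) a"
      using offset_add_eq_iff[of i Ns "offset (L i) j' + b" "points_map ?h x" "perm 0 (p (points_map ?h x)) a"]
        ik hk length_Ns by metis+
    have "points_map (fibre_map g f i) a = block (L i) (perm 0 (p i) a)"
      using shuffle.g[OF sp[OF ik], of a] a(2) by (simp flip: eq(1))
    also have "\<dots> = block (L i) (offset (L i) j' + b)"
      using eq by simp
    also have "\<dots> = j'"
      using bL j'(2) by (intro block_offset) (simp_all add: L_def)
    finally show ?thesis using eq(1) by simp
  qed

  show "points_map ?h x = points_map g (points_map f x)" if x: "x < cardinality (Dom C f)" for x
  proof -
    have "points_map f x < m" using points_map_position[OF g(2) x] g by (auto simp: m_def)
    then obtain j' where "j' < cardinality (fibre g (points_map g (points_map f x)))"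
      "F_eps m (points_map g) (points_map g (points_map f x)) j' = points_map f x"
      using points_map_position[OF g(1)] unfolding m_def by metis
    moreover obtain a where "a < cardinality (fibre ?h (points_map ?h x))"
      "F_eps (cardinality (Dom C f)) (points_map ?h) (points_map ?h x) a = x"
      using points_map_position[OF h(1)] x h by metis
    ultimately show ?thesis using main[OF x refl refl] by blast
  qed
  show "points_map (fibre_map g f i) a < cardinality (fibre g i) \<and>
      F_eps (cardinality (Dom C g)) (points_map g) i (points_map (fibre_map g f i) a) =
        points_map f (F_eps (cardinality (Dom C f)) (points_map ?h) i a)"
    if "i < cardinality (Cod C g)" "a < cardinality (fibre ?h i)" for i a
  proof -
    let ?x = "F_eps (cardinality (Dom C f)) (points_map ?h) i a"
    have ia: "i < length Ns" "a < Ns ! i" using that by (simp_all add: Ns_def k_def)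
    have x: "?x < cardinality (Dom C f)" using ia by (rule sh.eps_less)
    have hx: "points_map ?h ?x = i"
      using sh.g[OF x] sh.perm_eps[OF ia] block_offset[OF ia] by simp
    have "points_map f ?x < m" using points_map_position[OF g(2) x] g by (auto simp: m_def)
    then obtain j' where "j' < cardinality (fibre g (points_map g (points_map f ?x)))"
      "F_eps m (points_map g) (points_map g (points_map f ?x)) j' = points_map f ?x"
      using points_map_position[OF g(1)] unfolding m_def by metis
    then show ?thesis using main[OF x refl refl] hx that by (metis m_def)
  qed
  show "fibre (fibre_map g f i) j = fibre f (F_eps (cardinality (Dom C g)) (points_map g) i j)"
    if "i < cardinality (Cod C g)" "j < cardinality (fibre g i)" for i j
    using match that by (simp add: m_def k_def)
qed

text \<open>The fibres of an identity are chosen local terminals and have one point, so the induced map is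
  injective; being idempotent, it is the identity.\<close>
lemma points_map_Ident:
  assumes x: "x \<in> Obj C" and j: "j < cardinality x"
  shows "points_map (Ident C x) j = j"
proof -
  let ?I = "Ident C x"
  have I: "?I \<in> Arr C" "Dom C ?I = x" "Cod C ?I = x"
    using Ident_in_hom[OF x] by (auto simp: in_hom_def)
  have eps: "points_map ?I l < cardinality x \<and> F_eps (cardinality x) (points_map ?I) (points_map ?I l) 0 = l"
    if l: "l < cardinality x" for l
  proof -
    obtain a where a: "points_map ?I l < cardinality x" "a < cardinality (fibre ?I (points_map ?I l))"
      "F_eps (cardinality x) (points_map ?I) (points_map ?I l) a = l"
      using points_map_position[OF I(1), of l] l I by metis
    obtain c where "c \<in> components C" "fibre ?I (points_map ?I l) = t c"
      using tface_1_nth[OF x a(1)] by metis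
    then show ?thesis using a cardinality_t by simp
  qed
  have "Comp C ?I ?I = ?I" using Comp_Ident_right[OF I(1)] I by simp
  then have "points_map ?I (points_map ?I j) = points_map ?I j"
    using points_map_Comp[of ?I ?I j] I j by (simp add: composable_def)
  then show ?thesis using eps[OF j] eps[of "points_map ?I j"] by simp
qed

text \<open>A local terminal \<open>x\<close> is a retract of the chosen one \<open>u\<close> in its component: every point of \<open>x\<close> is the
  image of the only point of \<open>u\<close>.\<close>
lemma cardinality_local_terminal:
  assumes "local_terminal C x"
  shows "cardinality x = 1"
proof -
  let ?c = "component C x" and ?u = "to_terminal C t x"
  have x: "x \<in> Obj C" using assms by (simp add: local_terminal_def)
  then have c: "?c \<in> components C" by (simp add: components_def)
  obtain v where v: "in_hom C v (t ?c) x"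
    using assms t_in[OF c] by (auto simp: local_terminal_def)
  have u: "in_hom C ?u x (t ?c)" by (rule to_terminal_in_hom[OF x])
  have vu: "composable C v ?u" using u v by (simp add: composable_def in_hom_def)
  have "in_hom C (Comp C v ?u) x x" using Comp_in_hom[OF vu] u v by (simp add: in_hom_def)
  then have vu_id: "Comp C v ?u = Ident C x"
    using assms Ident_in_hom[OF x] component_refl[OF x] by (auto simp: local_terminal_def)
  have "points_map v 0 < cardinality x"
    using points_map_hom[of v] v cardinality_t[OF c] by (auto simp: in_hom_def F_hom_def)
  moreover have "j = points_map v 0" if "j < cardinality x" for j
  proof -
    have "points_map ?u j = 0"
      using points_map_hom[of ?u] u cardinality_t[OF c] that by (auto simp: in_hom_def F_hom_def)
    then show ?thesis
      using points_map_Comp[OF vu, of j] points_map_Ident[OF x that] that u vu_id by (simp add: in_hom_def)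
  qed
  ultimately show ?thesis by (metis less_one linorder_neqE_nat not_less0 zero_less_one nat_neq_iff)
qed

lemma points_map_Comp_compose:
  assumes gf: "composable C g f"
  shows "points_map (Comp C g f) = compose {..<cardinality (Dom C f)} (points_map g) (points_map f)"
proof
  fix j
  show "points_map (Comp C g f) j = compose {..<cardinality (Dom C f)} (points_map g) (points_map f) j"
  proof (cases "j < cardinality (Dom C f)")
    case True
    then show ?thesis using points_map_Comp[OF gf] by (simp add: compose_def)
  next
    case False
    then show ?thesis
      using points_map_hom[of "Comp C g f"] Comp_arrow[OF gf] by (auto simp: compose_def F_hom_def PiE_def extensional_def)
  qed
qed

lemma points_map_fibre_map:
  assumes gf: "composable C g f" and i: "i < cardinality (Cod C g)"
  shows "points_map (fibre_map g f i) =
    F_fib_map (cardinality (Dom C f)) (cardinality (Dom C g)) (points_map g) (points_map f) i"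
proof
  fix a
  note h = Comp_arrow[OF gf]
  have g: "g \<in> Arr C" using gf by (simp add: composable_def)
  have a_hom: "fibre_map g f i \<in> Arr C" "Dom C (fibre_map g f i) = fibre (Comp C g f) i"
    using tface_3_nth(2)[OF gf i] by (simp_all add: in_hom_def)
  have cardinality: "cardinality (fibre (Comp C g f) i) =
      F_fib (cardinality (Dom C f)) (compose {..<cardinality (Dom C f)} (points_map g) (points_map f)) i"
    using cardinality_fibre[OF h(1), of i] h i by (simp add: points_map_Comp_compose[OF gf])
  show "points_map (fibre_map g f i) a =
    F_fib_map (cardinality (Dom C f)) (cardinality (Dom C g)) (points_map g) (points_map f) i a"
  proof (cases "a < cardinality (fibre (Comp C g f) i)")
    case False
    then show ?thesis
      using points_map_hom[OF a_hom(1)] by (simp add: F_fib_map_def F_hom_def PiE_def extensional_def a_hom cardinality)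
  next
    case True
    have "(THE b. b < F_fib (cardinality (Dom C g)) (points_map g) i \<and> F_eps (cardinality (Dom C g)) (points_map g) i b =
        points_map f (F_eps (cardinality (Dom C f)) (points_map (Comp C g f)) i a)) = points_map (fibre_map g f i) a"
    proof (rule the_equality)
      show *: "points_map (fibre_map g f i) a < F_fib (cardinality (Dom C g)) (points_map g) i \<and>
        F_eps (cardinality (Dom C g)) (points_map g) i (points_map (fibre_map g f i) a) =
          points_map f (F_eps (cardinality (Dom C f)) (points_map (Comp C g f)) i a)"
        using fibre_map_eps[OF gf i True] cardinality_fibre[OF g i] by simp
      fix b
      assume "b < F_fib (cardinality (Dom C g)) (points_map g) i \<and> F_eps (cardinality (Dom C g)) (points_map g) i b =
        points_map f (F_eps (cardinality (Dom C f)) (points_map (Comp C g f)) i a)"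
      then show "b = points_map (fibre_map g f i) a"
        using shuffle.eps_inj[OF shuffle_arrow[OF g], of i b "points_map (fibre_map g f i) a"] * i cardinality_fibre[OF g i]
        by simp
    qed
    then show ?thesis using True by (simp add: F_fib_map_def cardinality points_map_Comp_compose[OF gf])
  qed
qed

text \<open>The permutation of \<open>\<beta>\<^sub>2\<close> at \<open>(h, f, g)\<close> is that of \<open>\<beta>\<^sub>0\<close> at \<open>g\<close>, and it matches the fibre maps of \<open>(h, f)\<close> with
  the fibre maps of the chains of fibre maps over the points of the target of \<open>g\<close>.\<close>
lemma fibre_map_fibre_map:
  assumes gf: "composable C g f" and fh: "composable C f h" and i: "i < cardinality (Cod C g)"
    and j: "j < cardinality (fibre g i)"
  shows "fibre_map (fibre_map g f i) (fibre_map (Comp C g f) h i) j =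
    fibre_map f h (F_eps (cardinality (Dom C g)) (points_map g) i j)"
proof -
  let ?\<sigma> = "Chain (Dom C h) [h, f, g]"
  let ?k = "cardinality (Cod C g)" and ?l = "F_eps (cardinality (Dom C g)) (points_map g) i j"
  have g: "g \<in> Arr C" "f \<in> Arr C" "h \<in> Arr C" "Dom C g = Cod C f" "Dom C f = Cod C h"
    using gf fh by (auto simp: composable_def)
  have gfh: "composable C (Comp C g f) h"
    using Comp_arrow[OF gf] g by (simp add: composable_def)
  have \<sigma>: "?\<sigma> \<in> N (Suc (Suc (Suc (Suc 0))))" using g by (simp add: Cod_Obj)
  define q where "q i' = Chain (fibre (Comp C (Comp C g f) h) i')
    [fibre_map (Comp C g f) h i', fibre_map g f i']" for i'
  have t4: "tface (Suc (Suc (Suc (Suc 0)))) ?\<sigma> = map q [0..<?k]"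
    by (rule nth_equalityI) (simp_all add: length_tface_4[OF gf fh] tface_4_nth[OF gf fh] q_def)
  define ns where "ns = map (\<lambda>i. cardinality (fibre g i)) [0..<?k]"
  interpret sg: shuffle ns "perm 0 (Chain (Dom C g) [g])" "cardinality (Dom C g)" "points_map g"
    unfolding ns_def using g by (intro shuffle_arrow)
  have ij: "i < length ns" "j < ns ! i" using i j by (simp_all add: ns_def)
  have l: "?l < cardinality (Cod C f)" "perm 0 (Chain (Dom C g) [g]) ?l = offset ns i + j"
    using sg.eps_less[OF ij] sg.perm_eps[OF ij] g by simp_all
  have perm: "perm (Suc (Suc 0)) ?\<sigma> = perm 0 (Chain (Dom C g) [g])"
    using perm_face_0[OF \<sigma>] perm_face_0[of "Chain (Dom C f) [f, g]" 0] g by (simp add: Cod_Obj)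
  have fib: "composable C (fibre_map g f i') (fibre_map (Comp C g f) h i')"
      "Dom C (fibre_map (Comp C g f) h i') = fibre (Comp C (Comp C g f) h) i'"
      "Cod C (fibre_map g f i') = fibre g i'" if "i' < ?k" for i'
    using tface_3_nth(2)[OF gf that] tface_3_nth(2)[OF gfh, of i'] Comp_arrow[OF gf] that
    by (simp_all add: in_hom_def composable_def)
  have len: "length (tface (Suc (Suc (Suc 0))) (q i')) = cardinality (fibre g i')" if "i' < ?k" for i'
    using length_tface_3[OF fib(1)[OF that]] fib(2,3)[OF that] by (simp add: q_def)
  have "length (tface (Suc (Suc (Suc 0))) (Chain (Dom C h) [h, f])) = sum_list (sizes (Suc (Suc 0)) ?\<sigma>)"
    using length_tface_face[OF \<sigma>] by simp
  then have "tface (Suc (Suc (Suc 0))) (Chain (Dom C h) [h, f]) ! ?l =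
      concat (map (tface (Suc (Suc (Suc 0)))) (map q [0..<?k])) ! (offset ns i + j)"
    using perm_nth[OF \<sigma>, of ?l] l length_tface_3[OF fh] by (simp add: perm t4)
  also have "map length (map (tface (Suc (Suc (Suc 0)))) (map q [0..<?k])) = ns"
    by (simp add: ns_def len)
  then have "concat (map (tface (Suc (Suc (Suc 0)))) (map q [0..<?k])) ! (offset ns i + j) =
    tface (Suc (Suc (Suc 0))) (q i) ! j"
    using nth_concat_offset[of i "map (tface (Suc (Suc (Suc 0)))) (map q [0..<?k])" j] i j
    by (simp add: len)
  also have "\<dots> = Chain (fibre (Comp C (fibre_map g f i) (fibre_map (Comp C g f) h i)) j)
      [fibre_map (fibre_map g f i) (fibre_map (Comp C g f) h i) j]"
    using tface_3_nth(1)[OF fib(1)[OF i], of j] fib(2,3)[OF i] j by (simp add: q_def)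
  finally show ?thesis using tface_3_nth(1)[OF fh l(1)] by simp
qed

lemma operadic_category_operadic: "operadic_category C t operadic"
proof unfold_locales
  fix f assume "f \<in> Arr C"
  then show "points_map f \<in> F_hom (cardinality (Dom C f)) (cardinality (Cod C f))" by (rule points_map_hom)
next
  fix x assume x: "x \<in> Obj C"
  show "points_map (Ident C x) = (\<lambda>j\<in>{..<cardinality x}. j)"
  proof
    fix j
    show "points_map (Ident C x) j = (\<lambda>j\<in>{..<cardinality x}. j) j"
      using points_map_Ident[OF x] points_map_hom[of "Ident C x"] Ident_in_hom[OF x]
      by (auto simp: F_hom_def in_hom_def PiE_def extensional_def)
  qed
next
  fix g f assume "composable C g f"
  then show "points_map (Comp C g f) = compose {..<cardinality (Dom C f)} (points_map g) (points_map f)"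
    by (rule points_map_Comp_compose)
next
  fix g i assume "g \<in> Arr C" "i < cardinality (Cod C g)"
  then show "fibre g i \<in> Obj C" by (rule tface_2_nth)
next
  fix g f i assume "composable C g f" "i < cardinality (Cod C g)"
  then show "in_hom C (fibre_map g f i) (fibre (Comp C g f) i) (fibre g i)" by (rule tface_3_nth)
next
  fix g i assume "g \<in> Arr C" "i < cardinality (Cod C g)"
  then show "fibre_map g (Ident C (Dom C g)) i = Ident C (fibre g i)" by (rule fibre_map_Ident)
next
  fix g f h i assume "composable C g f" "composable C f h" "i < cardinality (Cod C g)"
  then show "fibre_map g (Comp C f h) i = Comp C (fibre_map g f i) (fibre_map (Comp C g f) h i)"
    by (rule tface_4_nth)
next
  fix x assume "local_terminal C x"
  then show "cardinality x = 1" by (rule cardinality_local_terminal)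
next
  fix x i assume "x \<in> Obj C" "i < cardinality x"
  then show "fibre (Ident C x) i \<in> t ` components C" using tface_1_nth by blast
next
  fix g i assume "g \<in> Arr C" "i < cardinality (Cod C g)"
  then show "cardinality (fibre g i) = F_fib (cardinality (Dom C g)) (points_map g) i" by (rule cardinality_fibre)
next
  fix g f i assume "composable C g f" "i < cardinality (Cod C g)"
  then show "points_map (fibre_map g f i) =
      F_fib_map (cardinality (Dom C f)) (cardinality (Dom C g)) (points_map g) (points_map f) i" by (rule points_map_fibre_map)
next
  fix x assume "x \<in> Obj C"
  then show "fibre (to_terminal C t x) 0 = x" by (rule fibre_to_terminal_0)
next
  fix g assume "g \<in> Arr C"
  then show "fibre_map (to_terminal C t (Cod C g)) g 0 = g" by (rule fibre_map_to_terminal_0)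
next
  fix g f i j assume "composable C g f" "i < cardinality (Cod C g)" "j < F_fib (cardinality (Dom C g)) (points_map g) i"
  then show "fibre (fibre_map g f i) j = fibre f (F_eps (cardinality (Dom C g)) (points_map g) i j)"
    using fibre_fibre_map cardinality_fibre by (simp add: composable_def)
next
  fix g f h i j assume "composable C g f" "composable C f h" "i < cardinality (Cod C g)"
    "j < F_fib (cardinality (Dom C g)) (points_map g) i"
  then show "fibre_map (fibre_map g f i) (fibre_map (Comp C g f) h i) j =
      fibre_map f h (F_eps (cardinality (Dom C g)) (points_map g) i j)"
    using fibre_map_fibre_map cardinality_fibre by (simp add: composable_def)
qed

section \<open>Comparison with the operadic nerve\<close>

lemma composite_in_hom:
  "is_path C x fs \<Longrightarrow> fs \<noteq> [] \<Longrightarrow> in_hom C (composite C fs) x (Cod C (last fs))"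
proof (induction fs arbitrary: x rule: induct_list012)
  case (3 f g fs)
  then have "in_hom C (composite C (g # fs)) (Cod C f) (Cod C (last (g # fs)))" by simp
  then show ?case
    using 3(3) Comp_in_hom[of "composite C (g # fs)" f] by (auto simp: in_hom_def composable_def)
qed (auto simp: in_hom_def)

lemma composite_Comp:
  assumes "is_path C x (g # h # fs)"
  shows "composite C (Comp C h g # fs) = composite C (g # h # fs)"
proof (cases fs)
  case (Cons f fs')
  then have "in_hom C (composite C fs) (Cod C h) (Cod C (last fs))"
    using assms composite_in_hom[of "Cod C h" fs] by simp
  then show ?thesis
    using assms Cons Comp_assoc[of h g "composite C fs"] by (simp add: in_hom_def composable_def)
qed simp

lemma fibre_chain_Cons:
  "fibre_chain C P (f # g # fs) i = Chain (fib_ob P (composite C (f # g # fs)) i)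
     (fib_ar P (composite C (g # fs)) f i #
       map (\<lambda>l. fib_ar P (composite C (drop (l + 1) (g # fs))) ((g # fs) ! l) i) [0..<length (g # fs) - 1])"
proof -
  have "[0..<length (f # g # fs) - 1] = 0 # map Suc [0..<length (g # fs) - 1]"
    by (simp add: map_Suc_upt upt_conv_Cons del: upt_Suc)
  then show ?thesis by (simp add: fibre_chain_def comp_def)
qed

lemma vertex_length: "fs \<noteq> [] \<Longrightarrow> vertex C x fs (length fs) = Cod C (last fs)"
  by (simp add: vertex_def last_conv_nth)

text \<open>For a chain of at least three arrows, \<open>d\<^sub>0\<close> determines all of the chain of fibre maps but its first
  arrow, and \<open>d\<^sub>2\<close>, which keeps the first arrow, determines that one.  Both faces are shorter chains
  with the same last vertex.\<close>
lemma tface_nth_fibre_chain: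
  assumes "is_path C x fs" "fs \<noteq> []" "i < cardinality (Cod C (last fs))"
  shows "tface (Suc (length fs)) (Chain x fs) ! i = fibre_chain C operadic fs i"
  using assms
proof (induction "length fs" arbitrary: x fs rule: less_induct)
  case less
  consider f where "fs = [f]" | f g where "fs = [f, g]" | f g h fs' where "fs = f # g # h # fs'"
    using less.prems(2) by (metis neq_Nil_conv)
  then show ?case
  proof cases
    case 1
    then show ?thesis using less.prems tface_2_nth(1)[of f i] by (auto simp: fibre_chain_def)
  next
    case 2
    then have "composable C g f" using less.prems by (auto simp: composable_def)
    then show ?thesis using 2 less.prems tface_3_nth(1)[of g f i] by (auto simp: fibre_chain_def)
  next
    case (3 f g h fs')
    let ?\<sigma> = "Chain x fs" and ?n = "length fs'"
    have path: "f \<in> Arr C" "g \<in> Arr C" "h \<in> Arr C" "Dom C f = x" "Dom C g = Cod C f" "Dom C h = Cod C g"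
      "is_path C (Cod C h) fs'" using less.prems 3 by auto
    have hg: "composable C h g" using path by (simp add: composable_def)
    have \<sigma>: "?\<sigma> \<in> N (Suc (Suc (Suc (Suc ?n))))" using 3 less.prems by simp
    have "i < length (tface (Suc (length fs)) ?\<sigma>)"
      using length_tface_Chain[OF less.prems(1)] vertex_length[OF less.prems(2)] less.prems(3) by metis
    then have len: "i < length (tface (Suc (Suc (Suc (Suc ?n)))) ?\<sigma>)"
      using 3 by simp
    have "tface (Suc (Suc (Suc (Suc ?n)))) ?\<sigma> ! i \<in> N (Suc (Suc (Suc ?n)))"
      using \<sigma> len by (rule tface_nth_in)
    then obtain y a b as where e: "tface (Suc (Suc (Suc (Suc ?n)))) ?\<sigma> ! i = Chain y (a # b # as)" "length as = ?n"
      by (elim N_Suc_cases) (auto simp: length_Suc_conv)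
    have "Chain (Cod C a) (b # as) = tface (Suc (length (g # h # fs'))) (Chain (Cod C f) (g # h # fs')) ! i"
      using face_top_nth[OF _ \<sigma> len, of 0] e 3 by simp
    also have "\<dots> = fibre_chain C operadic (g # h # fs') i"
      using less.hyps[of "g # h # fs'" "Cod C f"] less.prems 3 by simp
    finally have b: "b # as = map (\<lambda>l. fibre_map (composite C (drop (l + 1) (g # h # fs'))) ((g # h # fs') ! l) i)
        [0..<length (g # h # fs') - 1]"
      by (simp add: fibre_chain_def)
    have "N_lt_face C (Suc (Suc 0)) (Chain y (a # b # as)) =
      tface (Suc (length (f # Comp C h g # fs'))) (Chain x (f # Comp C h g # fs')) ! i"
      using face_top_nth[OF _ \<sigma> len, of "Suc (Suc 0)"] e 3 by simp
    also have "\<dots> = fibre_chain C operadic (f # Comp C h g # fs') i"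
      using less.hyps[of "f # Comp C h g # fs'" x] less.prems 3 path Comp_arrow[OF hg]
      by (simp split: if_splits)
    also have "\<dots> = Chain (fibre (composite C (f # g # h # fs')) i)
       (fibre_map (composite C (g # h # fs')) f i #
         map (\<lambda>l. fibre_map (composite C (drop (l + 1) (Comp C h g # fs'))) ((Comp C h g # fs') ! l) i) [0..<length (Comp C h g # fs') - 1])"
      using composite_Comp[of "Dom C g" g h fs'] path
      by (simp only: fibre_chain_Cons composite.simps is_path.simps)
    finally have "y = fibre (composite C (f # g # h # fs')) i"
      "a = fibre_map (composite C (g # h # fs')) f i"
      by (auto split: if_splits)
    then show ?thesis
      using e b 3 by (simp only: fibre_chain_Cons length_Cons)
  qed
qed

lemma tface_N_opd_top:
  assumes "\<sigma> \<in> N (Suc r)"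
  shows "tface (Suc r) \<sigma> = N_opd_top C operadic \<sigma>"
proof -
  obtain x fs where \<sigma>: "\<sigma> = Chain x fs" "is_path C x fs" "length fs = r"
    using assms by (rule N_Suc_cases)
  show ?thesis
  proof (cases fs)
    case Nil
    have "tface (Suc 0) (Chain x []) ! i = Comp0 (component C (fibre (Ident C x) i))" if "i < cardinality x" for i
      using tface_1_nth[of x i] that \<sigma> Nil component_t by (metis is_path.simps(1))
    then show ?thesis
      using \<sigma> Nil by (intro nth_equalityI) (simp_all add: length_tface_1)
  next
    case (Cons f fs')
    have "length (tface (Suc r) \<sigma>) = cardinality (Cod C (last fs))"
      using length_tface_Chain[OF \<sigma>(2)] \<sigma> Cons by (auto simp: vertex_def last_conv_nth)
    then show ?thesis
      using tface_nth_fibre_chain[OF \<sigma>(2)] \<sigma> Cons by (intro nth_equalityI) simp_all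
  qed
qed

lemma perm_last:
  assumes "is_path C x fs" "length fs = Suc r"
  shows "perm r (Chain x fs) = perm 0 (Chain (Dom C (last fs)) [last fs])"
  using assms
proof (induction r arbitrary: x fs)
  case 0
  then show ?case by (auto simp: length_Suc_conv)
next
  case (Suc r)
  then obtain f g fs' where fs: "fs = f # g # fs'" by (auto simp: length_Suc_conv)
  have "perm (Suc r) (Chain x fs) = perm r (N_lt_face C 0 (Chain x fs))"
    using Suc.prems by (intro perm_face_0) simp
  then show ?case using Suc.IH[of "Cod C f" "g # fs'"] Suc.prems fs by simp
qed

lemma perm_F_pi:
  assumes "\<sigma> \<in> N (Suc (Suc r))"
  shows "perm r \<sigma> = F_pi (cardinality (Dom C (last_arrow \<sigma>))) (cardinality (Cod C (last_arrow \<sigma>))) (points_map (last_arrow \<sigma>))"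
proof -
  obtain x fs where \<sigma>: "\<sigma> = Chain x fs" "is_path C x fs" "length fs = Suc r"
    using assms by (rule N_Suc_cases)
  have "is_path C y gs \<Longrightarrow> gs \<noteq> [] \<Longrightarrow> last gs \<in> Arr C" for y gs
    by (induction gs arbitrary: y) auto
  then have "last fs \<in> Arr C" using \<sigma> by fastforce
  then show ?thesis
    using shuffle.F_pi[OF shuffle_arrow, of "last fs"] perm_last[OF \<sigma>(2,3)] \<sigma>
    by (simp add: last_arrow_def)
qed

lemma beta_N_opd:
  assumes "ps \<in> lists (N (Suc (Suc r)))"
  shows "beta X r ps = beta (N_opd C t operadic) r ps"
  using assms
proof (induction ps rule: list.induct)
  case Nil
  then show ?case by (simp add: beta_Nil N_opd_def)
next
  case (Cons p ps)
  then have p: "p \<in> N (Suc (Suc r))" "ps \<in> lists (N (Suc (Suc r)))" by auto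
  have f: "N_lt_face C (Suc r) p \<in> N (Suc r)" using p by (intro N_lt_face_in) auto
  have tops: "map (tface (Suc r)) (N_opd_top C operadic p) = map (N_opd_top C operadic) (N_opd_top C operadic p)"
    using tface_lists[OF p(1)] tface_N_opd_top[OF p(1)] tface_N_opd_top by auto
  have "N_opd_beta_gen C operadic r p = beta X r [p]"
    using p f
    by (simp add: beta_generator N_opd_beta_gen_def N_opd_face_def fcomp_def S_extend_def S_map_def
        tface_N_opd_top perm_F_pi tops)
  then show ?case
    using beta_append[of "[p]" r ps] p Cons.IH by (simp add: N_opd_def)
qed

lemma tps_eq_N_opd: "tps_eq X (N_opd C t operadic)"
  unfolding tps_eq_def
proof (intro conjI allI impI ballI)
  show "ssm_eq (lev X r) (lev (N_opd C t operadic) r)" for r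
    using lev_eq[of r] by (simp add: N_opd_def)
  show "ftr_eq (lev X r) (deg X r i) (deg (N_opd C t operadic) r i)" if "i \<le> r" for r i
    using deg_eq[OF that] by (simp add: N_opd_def)
  show "beta X r x = beta (N_opd C t operadic) r x" if "x \<in> Obj (lev X (r + 2))" for r x
    using beta_N_opd that by (simp add: Obj_lev)
  show "ftr_eq (lev X (Suc r)) (face X (Suc r) i) (face (N_opd C t operadic) (Suc r) i)"
    if "i \<le> Suc r" for r i
  proof (cases "i = Suc r")
    case False
    then show ?thesis using face_eq[of i "Suc r"] that by (simp add: N_opd_def N_opd_face_def)
  next
    case True
    have top: "map (tface (Suc r)) xs = map (N_opd_top C operadic) xs" if "xs \<in> lists (N (Suc r))" for xs
      using that tface_N_opd_top by auto
    have lengths: "map (length \<circ> tface (Suc r)) xs = map (length \<circ> N_opd_top C operadic) xs"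
      if "xs \<in> lists (N (Suc r))" for xs
      using that tface_N_opd_top by auto
    have "far (face X (Suc r) (Suc r)) a = far (S_extend (N_opd_top C operadic)) a"
      if "a \<in> Arr (S_groupoid (N (Suc r)))" for a
    proof -
      obtain xs \<rho> ys where a: "a = (xs, \<rho>, ys)" by (metis prod_cases3)
      then have "xs \<in> lists (N (Suc r))" "ys \<in> lists (N (Suc r))"
        using that by (simp_all add: Arr_S_groupoid_iff)
      then show ?thesis using far_top[OF that] by (simp add: S_extend_def a top lengths)
    qed
    moreover have "fob (face X (Suc r) (Suc r)) xs = fob (S_extend (N_opd_top C operadic)) xs"
      if "xs \<in> lists (N (Suc r))" for xs
      using that by (simp add: fob_top top S_extend_def)
    ultimately show ?thesis
      using True by (simp add: ftr_eq_def Obj_lev Arr_lev N_opd_def N_opd_face_def)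
  qed
qed

text \<open>The nerve of \<open>Q\<close> has the same top faces and 2-cells as \<open>X\<close>, so \<open>Q\<close> is recovered from \<open>X\<close> in the way
  in which \<open>operadic\<close> was defined.\<close>
lemma operadic_unique:
  assumes Q: "operadic_category C t Q" and X: "tps_eq X (N_opd C t Q)"
  shows "operadic_eq C operadic Q"
proof -
  interpret Q: operadic_category C t Q by (rule Q)
  have top: "tface (Suc r) \<sigma> = N_opd_top C Q \<sigma>" if "\<sigma> \<in> N (Suc r)" for r \<sigma>
  proof -
    have "ftr_eq (lev X (Suc r)) (face X (Suc r) (Suc r)) (face (N_opd C t Q) (Suc r) (Suc r))"
      using X by (simp add: tps_eq_def)
    then show ?thesis
      using that by (simp add: ftr_eq_def Obj_lev N_opd_def N_opd_face_def S_extend_def tface_def)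
  qed
  have cardinality: "cardinality x = card_ob Q x" if "x \<in> Obj C" for x
    using top[of "Chain x []" 0] length_tface_1[OF that] that by simp
  have fib: "fibre g i = fib_ob Q g i" if "g \<in> Arr C" "i < cardinality (Cod C g)" for g i
    using tface_2_nth(1)[OF that] top[of "Chain (Dom C g) [g]" "Suc 0"] that cardinality[of "Cod C g"]
    by (simp add: Cod_Obj fibre_chain_def)
  have fib_map: "fibre_map g f i = fib_ar Q g f i" if "composable C g f" "i < cardinality (Cod C g)" for g f i
    using tface_3_nth(1)[OF that] top[of "Chain (Dom C f) [f, g]" "Suc (Suc 0)"] that cardinality[of "Cod C g"]
    by (simp add: Cod_Obj fibre_chain_def composable_def)
  have perm: "perm 0 (Chain (Dom C f) [f]) j = F_pi (cardinality (Dom C f)) (cardinality (Cod C f)) (card_ar Q f) j"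
    if f: "f \<in> Arr C" and j: "j < cardinality (Dom C f)" for f j
  proof -
    let ?\<sigma> = "Chain (Dom C f) [f]"
    have "beta X 0 [?\<sigma>] = beta (N_opd C t Q) 0 [?\<sigma>]"
      using X f by (simp add: tps_eq_def Obj_lev Cod_Obj numeral_2_eq_2)
    moreover have "length (fst (N_opd_beta_gen C Q 0 ?\<sigma>)) = cardinality (Dom C f)"
      using f by (simp add: N_opd_beta_gen_def N_opd_face_def fcomp_def S_map_def S_extend_def cardinality Dom_Obj)
    ultimately have "perm 0 ?\<sigma> j = underlying (N_opd_beta_gen C Q 0 ?\<sigma>) j"
      using j by (simp add: perm_def N_opd_def S_groupoid_def split: prod.splits)
    then show ?thesis
      using f by (simp add: N_opd_beta_gen_def last_arrow_def cardinality Dom_Obj Cod_Obj)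
  qed
  have card_ar: "points_map f = card_ar Q f" if f: "f \<in> Arr C" for f
  proof
    fix j
    let ?n = "cardinality (Dom C f)" and ?k = "cardinality (Cod C f)"
    have Qf: "card_ar Q f \<in> F_hom ?n ?k" using Q.card_ar_hom[OF f] cardinality f by (simp add: Dom_Obj Cod_Obj)
    show "points_map f j = card_ar Q f j"
    proof (cases "j < ?n")
      case True
      have "cardinality (fibre f i) = F_fib ?n (card_ar Q f) i" if "i < ?k" for i
        using Q.A3_ob[OF f, of i] that cardinality f fib[OF f that] tface_2_nth(2)[OF f that]
        by (simp add: Dom_Obj Cod_Obj)
      then have ns: "map (\<lambda>i. cardinality (fibre f i)) [0..<?k] = map (F_fib ?n (card_ar Q f)) [0..<?k]"
        by simp
      have "points_map f j = block (map (F_fib ?n (card_ar Q f)) [0..<?k]) (perm 0 (Chain (Dom C f) [f]) j)"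
        using shuffle.g[OF shuffle_arrow[OF f] True] unfolding ns .
      then show ?thesis using block_F_pi[OF Qf True] perm[OF f True] by simp
    next
      case False
      then show ?thesis using Qf points_map_hom[OF f] by (simp add: F_hom_def PiE_def extensional_def)
    qed
  qed
  show ?thesis
    using cardinality card_ar fib fib_map by (simp add: operadic_eq_def)
qed

end

theorem theorem6p7:
  fixes C :: "('o, 'm) cat" and t :: "'o set \<Rightarrow> 'o"
    and X :: "(('o, 'm) simplex list, ('o, 'm) simplex sarrow) tps"
  assumes "category_with_local_terminals C t"
    and "top_pseudo_simplicial X"
    and "tsplit_ssm_eq (u_star X) (S_levelwise (N_lt C t))"
    and "shuffle_like X"
  shows "\<exists>P. operadic_category C t P \<and> tps_eq X (N_opd C t P) \<and>
    (\<forall>Q. operadic_category C t Q \<and> tps_eq X (N_opd C t Q) \<longrightarrow> operadic_eq C P Q)"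
proof -
  interpret shuffle_like_extension C t X
    using assms by (simp add: shuffle_like_extension_def shuffle_like_extension_axioms_def)
  show ?thesis
    using operadic_category_operadic tps_eq_N_opd operadic_unique by blast
qed

end
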